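(* Let $u:\mathbb R^{\bar d}\to\mathbb R$ be the transformer pretraining potential defined in the context, with depth $\mathsf L\ge1$. There exists a constant $c^\star=c^\star(d_{\mathrm m},d_{\mathrm h},H,\varepsilon,\tau,c_{qk},\mathsf L)$, independent of $\theta$, of $T$ and of the token sequence (distribution), such that for almost every $\theta\in\mathbb R^{\bar d}$ $$\nabla^2_\theta u(\theta)\succeq -c^\star\,(1+|\theta|)^{12\mathsf L+2}\,\mathrm I_{\bar d}.$$
   Context: $A\succeq B$ means $A-B$ is positive semi-definite; $\|\cdot\|_{\mathrm F}$ is the Frobenius norm. Constants: positive integers $\mathsf L$ (depth), $d_{\mathrm m}$ (width), $H$ (heads) with $d_{\mathrm h}=d_{\mathrm m}/H$ an integer, $V$ (vocabulary size), $T$ (context length), $d_{\mathrm f}=4d_{\mathrm m}$; reals $\varepsilon,\tau,c_{qk}>0$. Parameter: $\theta=(E,\{W_Q^\ell,W_K^\ell,W_V^\ell,W_O^\ell,W_1^\ell,W_2^\ell\}_{\ell=1}^{\mathsf L},W_{\mathrm{lm}})\in\mathbb R^{\bar d}$ with $E,W_{\mathrm{lm}}\in\mathbb R^{V\times d_{\mathrm m}}$, $W_Q^\ell,W_K^\ell,W_V^\ell,W_O^\ell\in\mathbb R^{d_{\mathrm m}\times d_{\mathrm m}}$, $W_1^\ell\in\mathbb R^{d_{\mathrm f}\times d_{\mathrm m}}$, $W_2^\ell\in\mathbb R^{d_{\mathrm m}\times d_{\mathrm f}}$, so $\bar d=2Vd_{\mathrm m}+12\mathsf L d_{\mathrm m}^2$,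 and $|\theta|$ is the Euclidean norm (sum of squared Frobenius norms). $W_{Q,i}^\ell\in\mathbb R^{d_{\mathrm h}\times d_{\mathrm m}}$, $i=1,\dots,H$, is the $i$-th block of $d_{\mathrm h}$ rows of $W_Q^\ell$; likewise for $K,V$. Nonlinearities: $\mathrm N_k(x)=x/(\frac1k|x|^2+\varepsilon)^{1/2}$ for $x\in\mathbb R^k$; $\mathrm{sm}(z)_i=e^{z_i}/\sum_je^{z_j}$; $\chi(z)=\tau\tanh(z/\tau)$ and $\varphi(z)=\max(z,0)^2$, both acting componentwise. Data: a token sequence $x=(x_0,\dots,x_T)\in\{1,\dots,V\}^{T+1}$ with inputs $x_0,\dots,x_{T-1}$ and targets $y_t=x_{t+1}$, $t=0,\dots,T-1$; $\mathcal D$ is a probability distribution on such sequences. $R_t\in\mathbb R^{d_{\mathrm h}\times d_{\mathrm h}}$ are fixed orthogonal matrices; $\mathcal S_\ell(t)\subseteq\{0,\dots,t\}$ are fixed nonempty attention windows. Forward map: $f^0_t=E^\top e_{x_t}\in\mathbb R^{d_{\mathrm m}}$. For $\ell=1,\dots,\mathsf L$: $\bar g_t^\ell=\mathrm N_{d_{\mathrm m}}(f_t^{\ell-1})$; $q_{t,i}^\ell=R_t\mathrm N_{d_{\mathrm h}}(W_{Q,i}^\ell\bar g_t^\ell)$, $k_{s,i}^\ell=R_s\mathrm N_{d_{\mathrm h}}(W_{K,i}^\ell\bar g_s^\ell)$; $a_{t,s,i}^\ell=\frac{c_{qk}}{\sqrt{d_{\mathrm h}}}\langle q_{t,i}^\ell,k_{s,i}^\ell\rangle$,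 $s\in\mathcal S_\ell(t)$; $p_{t,\cdot,i}^\ell=\mathrm{sm}(a_{t,\cdot,i}^\ell)$; $v_{s,i}^\ell=W_{V,i}^\ell\bar g_s^\ell$; $o_t^\ell=W_O^\ell\big(\bigoplus_{i=1}^H\sum_{s\in\mathcal S_\ell(t)}p_{t,s,i}^\ell v_{s,i}^\ell\big)$ (concatenation over $i$); $f_t^{\ell-1/2}=f_t^{\ell-1}+o_t^\ell$; $\bar b_t^\ell=\mathrm N_{d_{\mathrm m}}(f_t^{\ell-1/2})$; $m_t^\ell=W_2^\ell\varphi(W_1^\ell\bar b_t^\ell)$; $f_t^\ell=f_t^{\ell-1/2}+m_t^\ell$. Head: $z_t=\mathrm N_{d_{\mathrm m}}(f_t^{\mathsf L})$, $\zeta_t=W_{\mathrm{lm}}z_t\in\mathbb R^V$, $\hat\zeta_t=\chi(\zeta_t)$. Potential: $u(\theta)=\mathbb E_{x\sim\mathcal D}\big[\frac1T\sum_{t=0}^{T-1}\big(\log\sum_{j=1}^Ve^{\hat\zeta_{t,j}(\theta)}-\hat\zeta_{t,y_t}(\theta)\big)\big]$. *)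

theory Defs
  imports "HOL-Probability.Probability"
begin

section \<open>Gradient, Hessian and Loewner order in finitely many coordinates\<close>

text \<open>
  The constant in the theorem must not depend on the vocabulary size, while the dimension of the
  parameter space does. Dimensions are therefore terms rather than types: the Euclidean space over
  a finite index set \<open>I\<close> is \<open>I \<rightarrow>\<^sub>E UNIV\<close>, with norm \<open>L2_set _ I\<close> and Lebesgue measure
  \<open>\<Pi>\<^sub>M i\<in>I. lborel\<close>. Differentiability below is Frechet differentiability in this space.
\<close>

definition has_gradient_on ::
    "'i set \<Rightarrow> (('i \<Rightarrow> real) \<Rightarrow> real) \<Rightarrow> ('i \<Rightarrow> real) \<Rightarrow> ('i \<Rightarrow> real) \<Rightarrow> bool" where
  "has_gradient_on I F g \<theta> \<longleftrightarrow>
     (\<forall>e>0. \<exists>d>0. \<forall>\<theta>'\<in>I \<rightarrow>\<^sub>E UNIV. L2_set (\<lambda>i. \<theta>' i - \<theta> i) I < d \<longrightarrow>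
        \<bar>F \<theta>' - F \<theta> - (\<Sum>i\<in>I. g i * (\<theta>' i - \<theta> i))\<bar> \<le> e * L2_set (\<lambda>i. \<theta>' i - \<theta> i) I)"

text \<open>\<open>A i j\<close> is the derivative in direction \<open>j\<close> of the \<open>i\<close>-th component of the gradient.\<close>

definition has_hessian_on ::
    "'i set \<Rightarrow> (('i \<Rightarrow> real) \<Rightarrow> real) \<Rightarrow> ('i \<Rightarrow> 'i \<Rightarrow> real) \<Rightarrow> ('i \<Rightarrow> real) \<Rightarrow> bool" where
  "has_hessian_on I F A \<theta> \<longleftrightarrow>
     (\<exists>G. \<exists>r>0.
        (\<forall>\<theta>'\<in>I \<rightarrow>\<^sub>E UNIV. L2_set (\<lambda>i. \<theta>' i - \<theta> i) I < r \<longrightarrow> has_gradient_on I F (G \<theta>') \<theta>') \<and>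
        (\<forall>i\<in>I. has_gradient_on I (\<lambda>\<theta>'. G \<theta>' i) (A i) \<theta>))"

definition psd_on :: "'i set \<Rightarrow> ('i \<Rightarrow> 'i \<Rightarrow> real) \<Rightarrow> bool" where
  "psd_on I A \<longleftrightarrow>
     (\<forall>i\<in>I. \<forall>j\<in>I. A i j = A j i) \<and> (\<forall>v. 0 \<le> (\<Sum>i\<in>I. \<Sum>j\<in>I. v i * A i j * v j))"

definition loewner_ge_on ::
    "'i set \<Rightarrow> ('i \<Rightarrow> 'i \<Rightarrow> real) \<Rightarrow> ('i \<Rightarrow> 'i \<Rightarrow> real) \<Rightarrow> bool" where
  "loewner_ge_on I A B \<longleftrightarrow> psd_on I (\<lambda>i j. A i j - B i j)"

definition id_matrix :: "'i \<Rightarrow> 'i \<Rightarrow> real" where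
  "id_matrix i j = (if i = j then 1 else 0)"

lemma has_gradient_on_unique:
  assumes fin: "finite I" and th: "\<theta> \<in> I \<rightarrow>\<^sub>E UNIV" and i: "i \<in> I"
    and g: "has_gradient_on I F g \<theta>" and g': "has_gradient_on I F g' \<theta>"
  shows "g i = g' i"
proof (rule ccontr)
  assume ne: "g i \<noteq> g' i"
  define e where "e = \<bar>g i - g' i\<bar> / 4"
  have e: "e > 0" using ne by (simp add: e_def)
  obtain d where d: "d > 0" and D: "\<And>\<theta>'. \<theta>' \<in> I \<rightarrow>\<^sub>E UNIV \<Longrightarrow> L2_set (\<lambda>i. \<theta>' i - \<theta> i) I < d \<Longrightarrow>
      \<bar>F \<theta>' - F \<theta> - (\<Sum>i\<in>I. g i * (\<theta>' i - \<theta> i))\<bar> \<le> e * L2_set (\<lambda>i. \<theta>' i - \<theta> i) I"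
    using g e unfolding has_gradient_on_def by meson
  obtain d' where d': "d' > 0" and D': "\<And>\<theta>'. \<theta>' \<in> I \<rightarrow>\<^sub>E UNIV \<Longrightarrow> L2_set (\<lambda>i. \<theta>' i - \<theta> i) I < d' \<Longrightarrow>
      \<bar>F \<theta>' - F \<theta> - (\<Sum>i\<in>I. g' i * (\<theta>' i - \<theta> i))\<bar> \<le> e * L2_set (\<lambda>i. \<theta>' i - \<theta> i) I"
    using g' e unfolding has_gradient_on_def by meson
  define t where "t = min d d' / 2"
  have t: "t > 0" "t < d" "t < d'" using d d' by (auto simp: t_def)
  define p where "p = \<theta>(i := \<theta> i + t)"
  have p: "p \<in> I \<rightarrow>\<^sub>E UNIV" using th i by (auto simp: p_def PiE_def extensional_def)
  have diff: "(\<lambda>j. p j - \<theta> j) = (\<lambda>j. if j = i then t else 0)" by (auto simp: p_def)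
  have diffj: "p j - \<theta> j = (if j = i then t else 0)" for j by (simp add: p_def)
  have norm: "L2_set (\<lambda>j. p j - \<theta> j) I = t"
    unfolding diff L2_set_def using fin i t by (simp add: if_distrib[of "\<lambda>x. x^2"] cong: if_cong)
  have lin: "(\<Sum>j\<in>I. h j * (p j - \<theta> j)) = h i * t" for h :: "_ \<Rightarrow> real"
    unfolding diffj using fin i by (simp add: if_distrib[of "\<lambda>x. _ * x"] cong: if_cong)
  have "\<bar>F p - F \<theta> - g i * t\<bar> \<le> e * t" "\<bar>F p - F \<theta> - g' i * t\<bar> \<le> e * t"
    using D[OF p] D'[OF p] t by (auto simp: norm lin)
  hence "\<bar>g i * t - g' i * t\<bar> \<le> 2 * e * t" by linarith
  moreover have "\<bar>g i * t - g' i * t\<bar> = \<bar>g i - g' i\<bar> * t"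
    using t by (metis abs_mult abs_of_pos left_diff_distrib)
  ultimately have "\<bar>g i - g' i\<bar> \<le> 2 * e" using t by simp
  thus False using e by (simp add: e_def)
qed

lemma has_hessian_on_unique:
  assumes fin: "finite I" and th: "\<theta> \<in> I \<rightarrow>\<^sub>E UNIV" and ij: "i \<in> I" "j \<in> I"
    and A: "has_hessian_on I F A \<theta>" and B: "has_hessian_on I F B \<theta>"
  shows "A i j = B i j"
proof -
  obtain G r where r: "r > 0"
    and G: "\<And>p. p \<in> I \<rightarrow>\<^sub>E UNIV \<Longrightarrow> L2_set (\<lambda>i. p i - \<theta> i) I < r \<Longrightarrow> has_gradient_on I F (G p) p"
    and GA: "\<And>i. i \<in> I \<Longrightarrow> has_gradient_on I (\<lambda>p. G p i) (A i) \<theta>"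
    using A unfolding has_hessian_on_def by blast
  obtain K s where s: "s > 0"
    and K: "\<And>p. p \<in> I \<rightarrow>\<^sub>E UNIV \<Longrightarrow> L2_set (\<lambda>i. p i - \<theta> i) I < s \<Longrightarrow> has_gradient_on I F (K p) p"
    and KB: "\<And>i. i \<in> I \<Longrightarrow> has_gradient_on I (\<lambda>p. K p i) (B i) \<theta>"
    using B unfolding has_hessian_on_def by blast
  have eq: "G p i = K p i"
    if "p \<in> I \<rightarrow>\<^sub>E UNIV" "L2_set (\<lambda>i. p i - \<theta> i) I < min r s" for p
    using has_gradient_on_unique[OF fin that(1) ij(1) G K] that by simp
  have eq0: "G \<theta> i = K \<theta> i" using eq[OF th] r s by (simp add: L2_set_def)
  have "has_gradient_on I (\<lambda>p. G p i) (B i) \<theta>"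
    unfolding has_gradient_on_def
  proof (intro allI impI)
    fix e :: real assume "e > 0"
    then obtain d where d: "d > 0" and D: "\<forall>p\<in>I \<rightarrow>\<^sub>E UNIV. L2_set (\<lambda>i. p i - \<theta> i) I < d \<longrightarrow>
        \<bar>K p i - K \<theta> i - (\<Sum>j\<in>I. B i j * (p j - \<theta> j))\<bar> \<le> e * L2_set (\<lambda>i. p i - \<theta> i) I"
      using KB[OF ij(1)] unfolding has_gradient_on_def by meson
    show "\<exists>d>0. \<forall>p\<in>I \<rightarrow>\<^sub>E UNIV. L2_set (\<lambda>i. p i - \<theta> i) I < d \<longrightarrow>
        \<bar>G p i - G \<theta> i - (\<Sum>j\<in>I. B i j * (p j - \<theta> j))\<bar> \<le> e * L2_set (\<lambda>i. p i - \<theta> i) I"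
      using d r s D eq eq0 by (intro exI[of _ "min d (min r s)"]) auto
  qed
  thus ?thesis using has_gradient_on_unique[OF fin th ij(2) GA[OF ij(1)]] by blast
qed


section \<open>Parameters\<close>

text \<open>
  One constructor per weight matrix; the arguments are the layer (if any), the row and the column.
  Layers \<open>1..L\<close> and tokens \<open>1..V\<close> are counted from 1; all other matrix indices, positions and
  heads are counted from 0.
\<close>

datatype param =
    Emb nat nat
  | WQ nat nat nat | WK nat nat nat | WV nat nat nat | WO nat nat nat
  | W1 nat nat nat | W2 nat nat nat
  | LM nat nat

definition params :: "nat \<Rightarrow> nat \<Rightarrow> nat \<Rightarrow> param set" where
  "params L dm V =
     (\<lambda>(v, i). Emb v i) ` ({1..V} \<times> {..<dm}) \<union>
     (\<lambda>(l, i, j). WQ l i j) ` ({1..L} \<times> {..<dm} \<times> {..<dm}) \<union>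
     (\<lambda>(l, i, j). WK l i j) ` ({1..L} \<times> {..<dm} \<times> {..<dm}) \<union>
     (\<lambda>(l, i, j). WV l i j) ` ({1..L} \<times> {..<dm} \<times> {..<dm}) \<union>
     (\<lambda>(l, i, j). WO l i j) ` ({1..L} \<times> {..<dm} \<times> {..<dm}) \<union>
     (\<lambda>(l, i, j). W1 l i j) ` ({1..L} \<times> {..<4 * dm} \<times> {..<dm}) \<union>
     (\<lambda>(l, i, j). W2 l i j) ` ({1..L} \<times> {..<dm} \<times> {..<4 * dm}) \<union>
     (\<lambda>(v, i). LM v i) ` ({1..V} \<times> {..<dm})"

lemma finite_params: "finite (params L dm V)"
  by (simp add: params_def)

lemma card_params: "card (params L dm V) = 2 * V * dm + 12 * L * dm\<^sup>2"
proof -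
  have inj: "inj (\<lambda>(v, i). Emb v i)" "inj (\<lambda>(v, i). LM v i)"
    "inj (\<lambda>(l, i, j). WQ l i j)" "inj (\<lambda>(l, i, j). WK l i j)" "inj (\<lambda>(l, i, j). WV l i j)"
    "inj (\<lambda>(l, i, j). WO l i j)" "inj (\<lambda>(l, i, j). W1 l i j)" "inj (\<lambda>(l, i, j). W2 l i j)"
    by (auto simp: inj_def)
  note c = inj[THEN inj_on_subset[OF _ subset_UNIV], THEN card_image]
  show ?thesis
    unfolding params_def
    by (subst card_Un_disjoint, simp, simp, force)+
       (simp add: c power2_eq_square algebra_simps)
qed

abbreviation param_space :: "nat \<Rightarrow> nat \<Rightarrow> nat \<Rightarrow> (param \<Rightarrow> real) measure" where
  "param_space L dm V \<equiv> (\<Pi>\<^sub>M i\<in>params L dm V. lborel)"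


section \<open>The transformer potential\<close>

text \<open>
  A vector of dimension \<open>n\<close> is a function of which only the values at \<open>{..<n}\<close> matter (logit vectors
  are indexed by the tokens \<open>{1..V}\<close> instead).
\<close>

definition matvec :: "nat \<Rightarrow> (nat \<Rightarrow> nat \<Rightarrow> real) \<Rightarrow> (nat \<Rightarrow> real) \<Rightarrow> nat \<Rightarrow> real" where
  "matvec n W x = (\<lambda>i. \<Sum>j<n. W i j * x j)"

definition orthogonal_mat :: "nat \<Rightarrow> (nat \<Rightarrow> nat \<Rightarrow> real) \<Rightarrow> bool" where
  "orthogonal_mat n R \<longleftrightarrow> (\<forall>i<n. \<forall>j<n. (\<Sum>k<n. R k i * R k j) = (if i = j then 1 else 0))"

definition rmsnorm :: "real \<Rightarrow> nat \<Rightarrow> (nat \<Rightarrow> real) \<Rightarrow> nat \<Rightarrow> real" where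
  "rmsnorm eps k x = (\<lambda>i. x i / sqrt (1 / real k * (\<Sum>j<k. (x j)\<^sup>2) + eps))"

definition softmax :: "nat set \<Rightarrow> (nat \<Rightarrow> real) \<Rightarrow> nat \<Rightarrow> real" where
  "softmax S z s = exp (z s) / (\<Sum>j\<in>S. exp (z j))"

definition softcap :: "real \<Rightarrow> real \<Rightarrow> real" where
  "softcap tau z = tau * tanh (z / tau)"

definition sqrelu :: "real \<Rightarrow> real" where
  "sqrelu z = (max z 0)\<^sup>2"

text \<open>The \<open>i\<close>-th block of \<open>dh\<close> consecutive rows.\<close>

definition head_block :: "nat \<Rightarrow> nat \<Rightarrow> (nat \<Rightarrow> nat \<Rightarrow> real) \<Rightarrow> nat \<Rightarrow> nat \<Rightarrow> real" where
  "head_block dh i W = (\<lambda>r. W (i * dh + r))"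

text \<open>
  \<open>dm\<close> and \<open>dh\<close> are the model and head dimensions, so the number of heads is \<open>dm div dh\<close>.
  Attention at layer \<open>l\<close> and position \<open>t\<close> ranges over \<open>S l t\<close>. A family of activations is indexed
  by position first, and \<open>x ! t\<close> is the \<open>t\<close>-th token.
\<close>

context
  fixes L dm dh :: nat and eps tau cqk :: real and V T :: nat
    and R :: "nat \<Rightarrow> nat \<Rightarrow> nat \<Rightarrow> real" and S :: "nat \<Rightarrow> nat \<Rightarrow> nat set"
begin

definition query :: "(param \<Rightarrow> real) \<Rightarrow> nat \<Rightarrow> (nat \<Rightarrow> nat \<Rightarrow> real) \<Rightarrow> nat \<Rightarrow> nat \<Rightarrow> nat \<Rightarrow> real" where
  "query \<theta> l g t i =
     matvec dh (R t) (rmsnorm eps dh (matvec dm (head_block dh i (\<lambda>a b. \<theta> (WQ l a b))) (g t)))"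

definition key :: "(param \<Rightarrow> real) \<Rightarrow> nat \<Rightarrow> (nat \<Rightarrow> nat \<Rightarrow> real) \<Rightarrow> nat \<Rightarrow> nat \<Rightarrow> nat \<Rightarrow> real" where
  "key \<theta> l g s i =
     matvec dh (R s) (rmsnorm eps dh (matvec dm (head_block dh i (\<lambda>a b. \<theta> (WK l a b))) (g s)))"

definition val :: "(param \<Rightarrow> real) \<Rightarrow> nat \<Rightarrow> (nat \<Rightarrow> nat \<Rightarrow> real) \<Rightarrow> nat \<Rightarrow> nat \<Rightarrow> nat \<Rightarrow> real" where
  "val \<theta> l g s i = matvec dm (head_block dh i (\<lambda>a b. \<theta> (WV l a b))) (g s)"

definition att_logit ::
    "(param \<Rightarrow> real) \<Rightarrow> nat \<Rightarrow> (nat \<Rightarrow> nat \<Rightarrow> real) \<Rightarrow> nat \<Rightarrow> nat \<Rightarrow> nat \<Rightarrow> real" where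
  "att_logit \<theta> l g t i s =
     cqk / sqrt (real dh) * (\<Sum>r<dh. query \<theta> l g t i r * key \<theta> l g s i r)"

definition att_head ::
    "(param \<Rightarrow> real) \<Rightarrow> nat \<Rightarrow> (nat \<Rightarrow> nat \<Rightarrow> real) \<Rightarrow> nat \<Rightarrow> nat \<Rightarrow> nat \<Rightarrow> real" where
  "att_head \<theta> l g t i r =
     (\<Sum>s\<in>S l t. softmax (S l t) (att_logit \<theta> l g t i) s * val \<theta> l g s i r)"

text \<open>Component \<open>j\<close> of the concatenation of the heads is component \<open>j mod dh\<close> of head \<open>j div dh\<close>.\<close>

definition att_out ::
    "(param \<Rightarrow> real) \<Rightarrow> nat \<Rightarrow> (nat \<Rightarrow> nat \<Rightarrow> real) \<Rightarrow> nat \<Rightarrow> nat \<Rightarrow> real" where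
  "att_out \<theta> l g t =
     matvec dm (\<lambda>a b. \<theta> (WO l a b)) (\<lambda>j. att_head \<theta> l g t (j div dh) (j mod dh))"

definition mlp_out :: "(param \<Rightarrow> real) \<Rightarrow> nat \<Rightarrow> (nat \<Rightarrow> real) \<Rightarrow> nat \<Rightarrow> real" where
  "mlp_out \<theta> l b =
     matvec (4 * dm) (\<lambda>a c. \<theta> (W2 l a c)) (\<lambda>j. sqrelu (matvec dm (\<lambda>a c. \<theta> (W1 l a c)) b j))"

definition half_layer ::
    "(param \<Rightarrow> real) \<Rightarrow> nat \<Rightarrow> (nat \<Rightarrow> nat \<Rightarrow> real) \<Rightarrow> nat \<Rightarrow> nat \<Rightarrow> real" where
  "half_layer \<theta> l f = (\<lambda>t i. f t i + att_out \<theta> l (\<lambda>s. rmsnorm eps dm (f s)) t i)"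

definition full_layer ::
    "(param \<Rightarrow> real) \<Rightarrow> nat \<Rightarrow> (nat \<Rightarrow> nat \<Rightarrow> real) \<Rightarrow> nat \<Rightarrow> nat \<Rightarrow> real" where
  "full_layer \<theta> l f =
     (\<lambda>t i. half_layer \<theta> l f t i + mlp_out \<theta> l (rmsnorm eps dm (half_layer \<theta> l f t)) i)"

primrec residual :: "(param \<Rightarrow> real) \<Rightarrow> nat list \<Rightarrow> nat \<Rightarrow> nat \<Rightarrow> nat \<Rightarrow> real" where
  "residual \<theta> x 0 = (\<lambda>t i. \<theta> (Emb (x ! t) i))"
| "residual \<theta> x (Suc l) = full_layer \<theta> (Suc l) (residual \<theta> x l)"

definition logit :: "(param \<Rightarrow> real) \<Rightarrow> nat list \<Rightarrow> nat \<Rightarrow> nat \<Rightarrow> real" where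
  "logit \<theta> x t j =
     softcap tau (matvec dm (\<lambda>a b. \<theta> (LM a b)) (rmsnorm eps dm (residual \<theta> x L t)) j)"

definition seq_loss :: "(param \<Rightarrow> real) \<Rightarrow> nat list \<Rightarrow> real" where
  "seq_loss \<theta> x =
     1 / real T * (\<Sum>t<T. ln (\<Sum>j=1..V. exp (logit \<theta> x t j)) - logit \<theta> x t (x ! (t + 1)))"

definition potential :: "nat list pmf \<Rightarrow> (param \<Rightarrow> real) \<Rightarrow> real" where
  "potential D \<theta> = measure_pmf.expectation D (seq_loss \<theta>)"

end

text \<open>The token sequences \<open>x\<^sub>0, \<dots>, x\<^sub>T\<close>.\<close>

definition token_seqs :: "nat \<Rightarrow> nat \<Rightarrow> nat list set" where
  "token_seqs V T = {x. length x = T + 1 \<and> set x \<subseteq> {1..V}}"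

end

theory Submission
  imports Defs
begin

text \<open>
  Attach to a function twice differentiable at \<open>\<theta>\<close> a single number \<open>b\<close> that bounds its first directional
  derivatives in unit directions, while \<open>b\<^sup>2\<close> bounds the second ones. Such bounds add up under sums,
  are unchanged by convex combinations, obey the Leibniz rule under products of functions whose
  values are bounded by some \<open>a \<ge> 1\<close>, and scale under composition with smooth scalar functions.
  With \<open>\<rho> = 1 + |\<theta>|\<close>, attention and MLP each multiply the bound by a constant times \<open>\<rho>\<^sup>3\<close>, because
  normalisation makes the size of the residual stream irrelevant; the embedding has bound 1 and the
  head contributes one more \<open>\<rho>\<close>. The potential thus has bound \<open>C \<rho>\<^bsup>6L+1\<^esup>\<close>, and its square is the claim.
  Averages over positions, attention windows, tokens and sequences are convex combinations, which
  keeps \<open>C\<close> free of \<open>T\<close> and \<open>V\<close>.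

  The only obstacle to second differentiability is the kink of the squared ReLU. A pre-activation is
  linear in a row of \<open>W1\<close> with coefficients independent of that row, so by Fubini it vanishes only
  on a null set, provided the residual stream is almost surely nonzero; the latter follows by the
  same argument, layer by layer, from the affine dependence on \<open>W2\<close> and \<open>WO\<close>.
\<close>

section \<open>Gradients and Hessians\<close>

lemma has_gradient_onE:
  assumes "has_gradient_on I F g \<theta>" "e > 0"
  obtains d where "d > 0" "\<And>\<theta>'. \<theta>' \<in> I \<rightarrow>\<^sub>E UNIV \<Longrightarrow> L2_set (\<lambda>i. \<theta>' i - \<theta> i) I < d \<Longrightarrow>
      \<bar>F \<theta>' - F \<theta> - (\<Sum>i\<in>I. g i * (\<theta>' i - \<theta> i))\<bar> \<le> e * L2_set (\<lambda>i. \<theta>' i - \<theta> i) I"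
proof -
  from assms obtain d where "d > 0" "\<forall>\<theta>'\<in>I \<rightarrow>\<^sub>E UNIV. L2_set (\<lambda>i. \<theta>' i - \<theta> i) I < d \<longrightarrow>
      \<bar>F \<theta>' - F \<theta> - (\<Sum>i\<in>I. g i * (\<theta>' i - \<theta> i))\<bar> \<le> e * L2_set (\<lambda>i. \<theta>' i - \<theta> i) I"
    unfolding has_gradient_on_def by (elim allE[of _ e] impE exE conjE)
  thus thesis by (intro that[of d]) simp_all
qed

text \<open>Cauchy-Schwarz bounds the linear part by the norm of \<open>f\<close>, and the error
  tolerance 1 adds 1 to the slope. This local Lipschitz bound controls how far inner functions move
  in the chain rules below.\<close>

lemma has_gradient_on_increment:
  assumes "finite I" "has_gradient_on I F f \<theta>"
  obtains d M where "d > 0" "M > 0"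
    "\<And>\<theta>'. \<theta>' \<in> I \<rightarrow>\<^sub>E UNIV \<Longrightarrow> L2_set (\<lambda>i. \<theta>' i - \<theta> i) I < d \<Longrightarrow>
      \<bar>F \<theta>' - F \<theta>\<bar> \<le> M * L2_set (\<lambda>i. \<theta>' i - \<theta> i) I"
proof -
  obtain d where d: "d > 0" and D: "\<And>\<theta>'. \<theta>' \<in> I \<rightarrow>\<^sub>E UNIV \<Longrightarrow> L2_set (\<lambda>i. \<theta>' i - \<theta> i) I < d \<Longrightarrow>
      \<bar>F \<theta>' - F \<theta> - (\<Sum>i\<in>I. f i * (\<theta>' i - \<theta> i))\<bar> \<le> 1 * L2_set (\<lambda>i. \<theta>' i - \<theta> i) I"
    by (rule has_gradient_onE[OF assms(2) zero_less_one]) (rule that)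
  define M where "M = L2_set f I"
  have "\<bar>F \<theta>' - F \<theta>\<bar> \<le> (M + 1) * L2_set (\<lambda>i. \<theta>' i - \<theta> i) I"
    if "\<theta>' \<in> I \<rightarrow>\<^sub>E UNIV" "L2_set (\<lambda>i. \<theta>' i - \<theta> i) I < d" for \<theta>'
  proof -
    have "\<bar>\<Sum>i\<in>I. f i * (\<theta>' i - \<theta> i)\<bar> \<le> (\<Sum>i\<in>I. \<bar>f i\<bar> * \<bar>\<theta>' i - \<theta> i\<bar>)"
      by (rule order_trans[OF sum_abs]) (simp add: abs_mult)
    also have "\<dots> \<le> M * L2_set (\<lambda>i. \<theta>' i - \<theta> i) I"
      unfolding M_def by (rule L2_set_mult_ineq)
    finally show ?thesis using D[OF that] by (simp add: algebra_simps)
  qed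
  moreover have "M + 1 > 0" unfolding M_def by (simp add: add_nonneg_pos L2_set_nonneg)
  ultimately show thesis using d by (intro that[of d "M + 1"])
qed

text \<open>The outer function takes two arguments so that sums, products and scalar compositions
  are all instances. Its differentiability is the ordinary one on pairs of reals.\<close>

lemma has_gradient_on_chain2:
  assumes fin: "finite I" and F: "has_gradient_on I F f \<theta>" and G: "has_gradient_on I G g \<theta>"
    and h: "(h has_derivative (\<lambda>p. a * fst p + b * snd p)) (at (F \<theta>, G \<theta>))"
  shows "has_gradient_on I (\<lambda>\<theta>'. h (F \<theta>', G \<theta>')) (\<lambda>i. a * f i + b * g i) \<theta>"
  unfolding has_gradient_on_def
proof (intro allI impI)
  fix e :: real assume e: "e > 0"
  let ?n = "\<lambda>\<theta>'. L2_set (\<lambda>i. \<theta>' i - \<theta> i) I"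
  obtain d1 M1 where d1: "d1 > 0" "M1 > 0" and D1: "\<And>\<theta>'. \<theta>' \<in> I \<rightarrow>\<^sub>E UNIV \<Longrightarrow> ?n \<theta>' < d1 \<Longrightarrow>
      \<bar>F \<theta>' - F \<theta>\<bar> \<le> M1 * ?n \<theta>'"
    by (rule has_gradient_on_increment[OF fin F]) (rule that)
  obtain d2 M2 where d2: "d2 > 0" "M2 > 0" and D2: "\<And>\<theta>'. \<theta>' \<in> I \<rightarrow>\<^sub>E UNIV \<Longrightarrow> ?n \<theta>' < d2 \<Longrightarrow>
      \<bar>G \<theta>' - G \<theta>\<bar> \<le> M2 * ?n \<theta>'"
    by (rule has_gradient_on_increment[OF fin G]) (rule that)
  \<comment> \<open>Half of the error budget: the remainders of \<open>F\<close> and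
    \<open>G\<close> enter with weights \<open>\<bar>a\<bar>\<close> and
    \<open>\<bar>b\<bar>\<close>. The added 1 keeps the denominator positive.\<close>
  define e1 where "e1 = e / (2 * (\<bar>a\<bar> + \<bar>b\<bar> + 1))"
  have e1: "e1 > 0" "(\<bar>a\<bar> + \<bar>b\<bar>) * e1 \<le> e / 2"
    using e by (auto simp: e1_def field_simps add_nonneg_pos)
  obtain d3 where d3: "d3 > 0" and D3: "\<And>\<theta>'. \<theta>' \<in> I \<rightarrow>\<^sub>E UNIV \<Longrightarrow> ?n \<theta>' < d3 \<Longrightarrow>
      \<bar>F \<theta>' - F \<theta> - (\<Sum>i\<in>I. f i * (\<theta>' i - \<theta> i))\<bar> \<le> e1 * ?n \<theta>'"
    by (rule has_gradient_onE[OF F e1(1)]) (rule that)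
  obtain d4 where d4: "d4 > 0" and D4: "\<And>\<theta>'. \<theta>' \<in> I \<rightarrow>\<^sub>E UNIV \<Longrightarrow> ?n \<theta>' < d4 \<Longrightarrow>
      \<bar>G \<theta>' - G \<theta> - (\<Sum>i\<in>I. g i * (\<theta>' i - \<theta> i))\<bar> \<le> e1 * ?n \<theta>'"
    by (rule has_gradient_onE[OF G e1(1)]) (rule that)
  \<comment> \<open>The other half: the remainder of \<open>h\<close> is at most \<open>e2\<close>
    times the increment of the pair, which is at most \<open>M1 + M2\<close> times the increment of
    the parameter.\<close>
  define e2 where "e2 = e / (2 * (M1 + M2))"
  have M: "M1 + M2 > 0" using d1 d2 by simp
  have "e / (2 * X) * X = e / 2" if "X > 0" for X using that by simp
  hence e2: "e2 > 0" "e2 * (M1 + M2) = e / 2" unfolding e2_def using e M by (blast intro: divide_pos_pos mult_pos_pos zero_less_numeral)+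
  from h e2(1) obtain d5 where d5: "d5 > 0" and D5: "\<forall>p. norm (p - (F \<theta>, G \<theta>)) < d5 \<longrightarrow>
      norm (h p - h (F \<theta>, G \<theta>) - (a * fst (p - (F \<theta>, G \<theta>)) + b * snd (p - (F \<theta>, G \<theta>))))
        \<le> e2 * norm (p - (F \<theta>, G \<theta>))"
    unfolding has_derivative_at_alt by (elim conjE allE[of _ e2] impE exE)
  define d where "d = Min {d1, d2, d3, d4, d5 / (M1 + M2)}"
  have d: "d > 0" using d1 d2 d3 d4 d5 M by (simp add: d_def)
  have dle: "d \<le> d1" "d \<le> d2" "d \<le> d3" "d \<le> d4" "d \<le> d5 / (M1 + M2)" by (simp_all add: d_def)
  show "\<exists>d>0. \<forall>\<theta>'\<in>I \<rightarrow>\<^sub>E UNIV. ?n \<theta>' < d \<longrightarrow>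
    \<bar>h (F \<theta>', G \<theta>') - h (F \<theta>, G \<theta>) - (\<Sum>i\<in>I. (a * f i + b * g i) * (\<theta>' i - \<theta> i))\<bar> \<le> e * ?n \<theta>'"
  proof (intro exI[of _ d] conjI ballI impI d)
    fix \<theta>' assume th: "\<theta>' \<in> I \<rightarrow>\<^sub>E UNIV" and n: "?n \<theta>' < d"
    let ?p = "(F \<theta>', G \<theta>') - (F \<theta>, G \<theta>)"
    have np: "norm ?p \<le> (M1 + M2) * ?n \<theta>'"
    proof -
      have "norm ?p \<le> \<bar>F \<theta>' - F \<theta>\<bar> + \<bar>G \<theta>' - G \<theta>\<bar>"
        using norm_Pair_le[of "F \<theta>' - F \<theta>" "G \<theta>' - G \<theta>"] by simp
      thus ?thesis using D1[OF th] D2[OF th] n dle by (simp add: algebra_simps)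
    qed
    have "(M1 + M2) * ?n \<theta>' < (M1 + M2) * d" using n M by simp
    also have "\<dots> \<le> d5" using dle(5) M by (simp add: pos_le_divide_eq mult.commute)
    finally have "(M1 + M2) * ?n \<theta>' < d5" .
    hence 1: "\<bar>h (F \<theta>', G \<theta>') - h (F \<theta>, G \<theta>) - (a * (F \<theta>' - F \<theta>) + b * (G \<theta>' - G \<theta>))\<bar>
        \<le> e2 * norm ?p" using D5[rule_format, of "(F \<theta>', G \<theta>')"] np by simp
    have "e2 * norm ?p \<le> e2 * ((M1 + M2) * ?n \<theta>')" using np e2(1) by (intro mult_left_mono) auto
    also have "\<dots> = e / 2 * ?n \<theta>'" by (simp only: mult.assoc[symmetric] e2(2))
    finally have 2: "e2 * norm ?p \<le> e / 2 * ?n \<theta>'" .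
    let ?x = "F \<theta>' - F \<theta> - (\<Sum>i\<in>I. f i * (\<theta>' i - \<theta> i))"
    let ?y = "G \<theta>' - G \<theta> - (\<Sum>i\<in>I. g i * (\<theta>' i - \<theta> i))"
    have xy: "\<bar>?x\<bar> \<le> e1 * ?n \<theta>'" "\<bar>?y\<bar> \<le> e1 * ?n \<theta>'" using D3[OF th] D4[OF th] n dle by auto
    have "\<bar>a * ?x + b * ?y\<bar> \<le> \<bar>a\<bar> * \<bar>?x\<bar> + \<bar>b\<bar> * \<bar>?y\<bar>"
      unfolding abs_mult[symmetric] by (rule abs_triangle_ineq)
    also have "\<dots> \<le> \<bar>a\<bar> * (e1 * ?n \<theta>') + \<bar>b\<bar> * (e1 * ?n \<theta>')"
      using xy by (intro add_mono mult_left_mono) auto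
    also have "\<dots> = ((\<bar>a\<bar> + \<bar>b\<bar>) * e1) * ?n \<theta>'" by (simp add: algebra_simps)
    also have "\<dots> \<le> e / 2 * ?n \<theta>'" using e1 by (intro mult_right_mono) (auto simp: L2_set_nonneg)
    finally have 3: "\<bar>a * ?x + b * ?y\<bar> \<le> e / 2 * ?n \<theta>'" .
    have 4: "(\<Sum>i\<in>I. (a * f i + b * g i) * (\<theta>' i - \<theta> i))
      = a * (\<Sum>i\<in>I. f i * (\<theta>' i - \<theta> i)) + b * (\<Sum>i\<in>I. g i * (\<theta>' i - \<theta> i))"
      by (simp add: sum_distrib_left sum.distrib distrib_right mult.assoc)
    have "h (F \<theta>', G \<theta>') - h (F \<theta>, G \<theta>) - (\<Sum>i\<in>I. (a * f i + b * g i) * (\<theta>' i - \<theta> i))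
      = (h (F \<theta>', G \<theta>') - h (F \<theta>, G \<theta>) - (a * (F \<theta>' - F \<theta>) + b * (G \<theta>' - G \<theta>)))
        + (a * ?x + b * ?y)"
      unfolding 4 by (simp add: algebra_simps)
    thus "\<bar>h (F \<theta>', G \<theta>') - h (F \<theta>, G \<theta>) - (\<Sum>i\<in>I. (a * f i + b * g i) * (\<theta>' i - \<theta> i))\<bar>
      \<le> e * ?n \<theta>'"
      using 1 2 3 by linarith
  qed
qed

lemma has_gradient_on_const: "has_gradient_on I (\<lambda>_. k) (\<lambda>_. 0) \<theta>"
  unfolding has_gradient_on_def by (auto intro!: exI[of _ 1] mult_nonneg_nonneg simp: L2_set_nonneg)

lemma has_gradient_on_coord:
  assumes "finite I" "p \<in> I"
  shows "has_gradient_on I (\<lambda>\<theta>. \<theta> p) (\<lambda>i. if i = p then 1 else 0) \<theta>"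
proof -
  have "(\<Sum>i\<in>I. (if i = p then 1 else 0) * (\<theta>' i - \<theta> i)) = \<theta>' p - \<theta> p" for \<theta>'
    using assms by (simp add: if_distrib[of "\<lambda>x. x * _"] cong: if_cong)
  thus ?thesis unfolding has_gradient_on_def
    by (auto intro!: exI[of _ 1] mult_nonneg_nonneg simp: L2_set_nonneg)
qed

lemma has_gradient_on_add:
  assumes "finite I" "has_gradient_on I F f \<theta>" "has_gradient_on I G g \<theta>"
  shows "has_gradient_on I (\<lambda>\<theta>'. F \<theta>' + G \<theta>') (\<lambda>i. f i + g i) \<theta>"
proof -
  have "((\<lambda>p. fst p + snd p) has_derivative (\<lambda>p. 1 * fst p + 1 * snd p)) (at (F \<theta>, G \<theta>))"
    using has_derivative_add[OF has_derivative_fst[OF has_derivative_ident] has_derivative_snd[OF has_derivative_ident]]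
    by simp
  from has_gradient_on_chain2[where I = I and F = F and f = f and \<theta> = \<theta> and G = G and g = g and h = "\<lambda>p. fst p + snd p" and a = 1 and b = 1, OF assms this]
  show ?thesis by simp
qed

lemma has_gradient_on_mult:
  assumes "finite I" "has_gradient_on I F f \<theta>" "has_gradient_on I G g \<theta>"
  shows "has_gradient_on I (\<lambda>\<theta>'. F \<theta>' * G \<theta>') (\<lambda>i. G \<theta> * f i + F \<theta> * g i) \<theta>"
proof -
  have "((\<lambda>p. fst p * snd p) has_derivative (\<lambda>p. G \<theta> * fst p + F \<theta> * snd p)) (at (F \<theta>, G \<theta>))"
    using has_derivative_mult[OF has_derivative_fst[OF has_derivative_ident]
        has_derivative_snd[OF has_derivative_ident], of "(F \<theta>, G \<theta>)" UNIV]
    by (simp add: mult.commute add.commute)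
  from has_gradient_on_chain2[where I = I and F = F and f = f and \<theta> = \<theta> and G = G and g = g and h = "\<lambda>p. fst p * snd p" and a = "G \<theta>" and b = "F \<theta>", OF assms this]
  show ?thesis by simp
qed

lemma has_gradient_on_comp:
  assumes "finite I" "has_gradient_on I F f \<theta>" "(h has_real_derivative a) (at (F \<theta>))"
  shows "has_gradient_on I (\<lambda>\<theta>'. h (F \<theta>')) (\<lambda>i. a * f i) \<theta>"
proof -
  have "(h has_derivative (\<lambda>x. a * x)) (at (fst (F \<theta>, F \<theta>)))"
    using assms(3) by (simp add: has_field_derivative_def)
  from has_derivative_compose[OF has_derivative_fst[OF has_derivative_ident] this]
  have "((\<lambda>p. h (fst p)) has_derivative (\<lambda>p. a * fst p + 0 * snd p)) (at (F \<theta>, F \<theta>))" by simp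
  from has_gradient_on_chain2[where I = I and F = F and f = f and \<theta> = \<theta> and G = F and g = f and h = "\<lambda>p. h (fst p)" and a = a and b = 0, OF assms(1,2,2) this] show ?thesis by simp
qed

section \<open>Second-order calculus at a point\<close>

text \<open>Unlike in \<open>has_hessian_on\<close>, the gradient field \<open>G\<close> is exposed,
  because the product and chain rules need its value at \<theta>. Symmetry of \<open>A\<close> is
  carried along: each rule below preserves it, so no theorem on mixed partial derivatives has to be
  invoked.\<close>

definition hessian_at ::
  "'i set \<Rightarrow> ('i \<Rightarrow> real) \<Rightarrow> (('i \<Rightarrow> real) \<Rightarrow> real) \<Rightarrow> (('i \<Rightarrow> real) \<Rightarrow> 'i \<Rightarrow> real) \<Rightarrow> ('i \<Rightarrow> 'i \<Rightarrow> real) \<Rightarrow> bool"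
  where "hessian_at I \<theta> F G A \<longleftrightarrow> \<theta> \<in> I \<rightarrow>\<^sub>E UNIV \<and>
     (\<exists>r>0. \<forall>\<theta>'\<in>I \<rightarrow>\<^sub>E UNIV. L2_set (\<lambda>i. \<theta>' i - \<theta> i) I < r \<longrightarrow> has_gradient_on I F (G \<theta>') \<theta>') \<and>
     (\<forall>i\<in>I. has_gradient_on I (\<lambda>\<theta>'. G \<theta>' i) (A i) \<theta>) \<and> (\<forall>i\<in>I. \<forall>j\<in>I. A i j = A j i)"

lemma hessian_atI:
  assumes "\<theta> \<in> I \<rightarrow>\<^sub>E UNIV" "r > 0"
    and "\<And>\<theta>'. \<theta>' \<in> I \<rightarrow>\<^sub>E UNIV \<Longrightarrow> L2_set (\<lambda>i. \<theta>' i - \<theta> i) I < r \<Longrightarrow> has_gradient_on I F (G \<theta>') \<theta>'"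
    and "\<And>i. i \<in> I \<Longrightarrow> has_gradient_on I (\<lambda>\<theta>'. G \<theta>' i) (A i) \<theta>"
    and "\<And>i j. i \<in> I \<Longrightarrow> j \<in> I \<Longrightarrow> A i j = A j i"
  shows "hessian_at I \<theta> F G A"
  unfolding hessian_at_def using assms(1,2,4,5)
  by (intro conjI exI[of _ r] ballI impI assms(3)) auto

lemma hessian_atE:
  assumes "hessian_at I \<theta> F G A"
  obtains r where "r > 0"
    "\<And>\<theta>'. \<theta>' \<in> I \<rightarrow>\<^sub>E UNIV \<Longrightarrow> L2_set (\<lambda>i. \<theta>' i - \<theta> i) I < r \<Longrightarrow> has_gradient_on I F (G \<theta>') \<theta>'"
proof -
  from assms obtain r where "r > 0"
    "\<forall>\<theta>'\<in>I \<rightarrow>\<^sub>E UNIV. L2_set (\<lambda>i. \<theta>' i - \<theta> i) I < r \<longrightarrow> has_gradient_on I F (G \<theta>') \<theta>'"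
    unfolding hessian_at_def by (elim exE conjE)
  thus thesis by (intro that[of r]) simp_all
qed

lemma hessian_atD:
  assumes "hessian_at I \<theta> F G A"
  shows "\<theta> \<in> I \<rightarrow>\<^sub>E UNIV"
    and "i \<in> I \<Longrightarrow> has_gradient_on I (\<lambda>\<theta>'. G \<theta>' i) (A i) \<theta>"
    and "i \<in> I \<Longrightarrow> j \<in> I \<Longrightarrow> A i j = A j i"
  using assms unfolding hessian_at_def by simp_all

lemma hessian_at_gradient:
  assumes "hessian_at I \<theta> F G A" shows "has_gradient_on I F (G \<theta>) \<theta>"
  by (rule hessian_atE[OF assms]) (use hessian_atD(1)[OF assms] in \<open>simp add: L2_set_def\<close>)

lemma hessian_at_const:
  "\<theta> \<in> I \<rightarrow>\<^sub>E UNIV \<Longrightarrow> hessian_at I \<theta> (\<lambda>_. k) (\<lambda>_ _. 0) (\<lambda>_ _. 0)"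
  by (rule hessian_atI[where r = 1]) (simp_all add: has_gradient_on_const)

lemma hessian_at_coord:
  "finite I \<Longrightarrow> \<theta> \<in> I \<rightarrow>\<^sub>E UNIV \<Longrightarrow> p \<in> I \<Longrightarrow>
    hessian_at I \<theta> (\<lambda>\<theta>. \<theta> p) (\<lambda>_ i. if i = p then 1 else 0) (\<lambda>_ _. 0)"
  by (rule hessian_atI[where r = 1]) (simp_all add: has_gradient_on_const has_gradient_on_coord)

lemma hessian_at_add:
  assumes fin: "finite I" and F: "hessian_at I \<theta> F G A" and F': "hessian_at I \<theta> F' G' A'"
  shows "hessian_at I \<theta> (\<lambda>\<theta>. F \<theta> + F' \<theta>) (\<lambda>\<theta> i. G \<theta> i + G' \<theta> i) (\<lambda>i j. A i j + A' i j)"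
proof -
  obtain r where r: "r > 0" "\<And>p. p \<in> I \<rightarrow>\<^sub>E UNIV \<Longrightarrow> L2_set (\<lambda>i. p i - \<theta> i) I < r \<Longrightarrow> has_gradient_on I F (G p) p"
    by (rule hessian_atE[OF F]) (rule that)
  obtain r' where r': "r' > 0" "\<And>p. p \<in> I \<rightarrow>\<^sub>E UNIV \<Longrightarrow> L2_set (\<lambda>i. p i - \<theta> i) I < r' \<Longrightarrow> has_gradient_on I F' (G' p) p"
    by (rule hessian_atE[OF F']) (rule that)
  show ?thesis
  proof (rule hessian_atI[where r = "min r r'"])
    fix p assume "p \<in> I \<rightarrow>\<^sub>E UNIV" "L2_set (\<lambda>i. p i - \<theta> i) I < min r r'"
    thus "has_gradient_on I (\<lambda>\<theta>. F \<theta> + F' \<theta>) (\<lambda>i. G p i + G' p i) p"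
      using has_gradient_on_add[OF fin r(2) r'(2)] by simp
  next
    fix i assume "i \<in> I"
    thus "has_gradient_on I (\<lambda>p. G p i + G' p i) (\<lambda>j. A i j + A' i j) \<theta>"
      by (intro has_gradient_on_add[OF fin hessian_atD(2)[OF F] hessian_atD(2)[OF F']])
  qed (use r(1) r'(1) hessian_atD(1,3)[OF F] hessian_atD(3)[OF F'] in simp_all)
qed

text \<open>The product rule for gradients holds on a whole neighbourhood, so each component of the
  resulting gradient is again a sum of products and can be differentiated once more.\<close>

lemma hessian_at_mult:
  assumes fin: "finite I" and F: "hessian_at I \<theta> F G A" and F': "hessian_at I \<theta> F' G' A'"
  shows "hessian_at I \<theta> (\<lambda>\<theta>. F \<theta> * F' \<theta>) (\<lambda>\<theta> i. F' \<theta> * G \<theta> i + F \<theta> * G' \<theta> i)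
    (\<lambda>i j. (G \<theta> i * G' \<theta> j + F' \<theta> * A i j) + (G' \<theta> i * G \<theta> j + F \<theta> * A' i j))"
proof -
  obtain r where r: "r > 0" "\<And>p. p \<in> I \<rightarrow>\<^sub>E UNIV \<Longrightarrow> L2_set (\<lambda>i. p i - \<theta> i) I < r \<Longrightarrow> has_gradient_on I F (G p) p"
    by (rule hessian_atE[OF F]) (rule that)
  obtain r' where r': "r' > 0" "\<And>p. p \<in> I \<rightarrow>\<^sub>E UNIV \<Longrightarrow> L2_set (\<lambda>i. p i - \<theta> i) I < r' \<Longrightarrow> has_gradient_on I F' (G' p) p"
    by (rule hessian_atE[OF F']) (rule that)
  show ?thesis
  proof (rule hessian_atI[where r = "min r r'"])
    fix p assume "p \<in> I \<rightarrow>\<^sub>E UNIV" "L2_set (\<lambda>i. p i - \<theta> i) I < min r r'"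
    thus "has_gradient_on I (\<lambda>\<theta>. F \<theta> * F' \<theta>) (\<lambda>i. F' p * G p i + F p * G' p i) p"
      using has_gradient_on_mult[OF fin r(2) r'(2)] by simp
  next
    fix i assume i: "i \<in> I"
    show "has_gradient_on I (\<lambda>p. F' p * G p i + F p * G' p i)
        (\<lambda>j. (G \<theta> i * G' \<theta> j + F' \<theta> * A i j) + (G' \<theta> i * G \<theta> j + F \<theta> * A' i j)) \<theta>"
      by (rule has_gradient_on_add[OF fin
            has_gradient_on_mult[OF fin hessian_at_gradient[OF F'] hessian_atD(2)[OF F i]]
            has_gradient_on_mult[OF fin hessian_at_gradient[OF F] hessian_atD(2)[OF F' i]]])
  qed (use r(1) r'(1) hessian_atD(1,3)[OF F] hessian_atD(3)[OF F'] in simp_all)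
qed

lemma hessian_at_comp:
  assumes fin: "finite I" and F: "hessian_at I \<theta> F G A" and e: "e > 0"
    and h: "\<And>y. \<bar>y - F \<theta>\<bar> < e \<Longrightarrow> (h has_real_derivative h' y) (at y)"
    and h': "(h' has_real_derivative h2) (at (F \<theta>))"
  shows "hessian_at I \<theta> (\<lambda>\<theta>. h (F \<theta>)) (\<lambda>\<theta> i. h' (F \<theta>) * G \<theta> i)
    (\<lambda>i j. G \<theta> i * (h2 * G \<theta> j) + h' (F \<theta>) * A i j)"
proof -
  note g = hessian_at_gradient[OF F]
  obtain r where r: "r > 0" "\<And>p. p \<in> I \<rightarrow>\<^sub>E UNIV \<Longrightarrow> L2_set (\<lambda>i. p i - \<theta> i) I < r \<Longrightarrow> has_gradient_on I F (G p) p"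
    by (rule hessian_atE[OF F]) (rule that)
  obtain d M where d: "d > 0" "M > 0" and D: "\<And>\<theta>'. \<theta>' \<in> I \<rightarrow>\<^sub>E UNIV \<Longrightarrow> L2_set (\<lambda>i. \<theta>' i - \<theta> i) I < d \<Longrightarrow>
      \<bar>F \<theta>' - F \<theta>\<bar> \<le> M * L2_set (\<lambda>i. \<theta>' i - \<theta> i) I"
    by (rule has_gradient_on_increment[OF fin g]) (rule that)
  show ?thesis
  \<comment> \<open>Within radius \<open>e / M\<close> the increment bound keeps \<open>F\<close>
    within \<open>e\<close> of \<open>F \<theta>\<close>, the region where \<open>h'\<close> is
    known to be the derivative of \<open>h\<close>.\<close>
  proof (rule hessian_atI[where r = "min r (min d (e / M))"])
    show "0 < min r (min d (e / M))" using r(1) d e by simp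
    fix p assume p: "p \<in> I \<rightarrow>\<^sub>E UNIV" and n: "L2_set (\<lambda>i. p i - \<theta> i) I < min r (min d (e / M))"
    have "M * L2_set (\<lambda>i. p i - \<theta> i) I < e" using n d(2) by (simp add: pos_less_divide_eq mult.commute)
    hence "\<bar>F p - F \<theta>\<bar> < e" using D[OF p] n by simp
    hence "(h has_real_derivative h' (F p)) (at (F p))" by (rule h)
    moreover have "has_gradient_on I F (G p) p" using r(2)[OF p] n by simp
    ultimately show "has_gradient_on I (\<lambda>\<theta>. h (F \<theta>)) (\<lambda>i. h' (F p) * G p i) p"
      using has_gradient_on_comp[where F = F and h = h and \<theta> = p, OF fin] by blast
  next
    fix i assume i: "i \<in> I"
    have "has_gradient_on I (\<lambda>p. h' (F p)) (\<lambda>i. h2 * G \<theta> i) \<theta>"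
      by (rule has_gradient_on_comp[where F = F and h = h' and \<theta> = \<theta>, OF fin g h'])
    from has_gradient_on_mult[OF fin this hessian_atD(2)[OF F i]]
    show "has_gradient_on I (\<lambda>p. h' (F p) * G p i)
      (\<lambda>j. G \<theta> i * (h2 * G \<theta> j) + h' (F \<theta>) * A i j) \<theta>" .
  qed (use hessian_atD(1,3)[OF F] in simp_all)
qed

section \<open>Bounds on first and second directional derivatives\<close>

text \<open>Pairing \<open>b\<close> with \<open>b\<^sup>2\<close> makes the bound stable under
  products: the cross terms of the Leibniz rule fit into the square. Only the quadratic form of the
  Hessian is bounded, which is all the Loewner order sees. Values of \<open>F\<close> are bounded
  separately where a product requires it.\<close>

definition jet_le :: "'i set \<Rightarrow> ('i \<Rightarrow> real) \<Rightarrow> (('i \<Rightarrow> real) \<Rightarrow> real) \<Rightarrow> real \<Rightarrow> bool" where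
  "jet_le I \<theta> F b \<longleftrightarrow> (\<exists>G A. hessian_at I \<theta> F G A \<and>
     (\<forall>v. L2_set v I \<le> 1 \<longrightarrow> \<bar>\<Sum>i\<in>I. G \<theta> i * v i\<bar> \<le> b \<and>
       \<bar>\<Sum>i\<in>I. \<Sum>j\<in>I. v i * A i j * v j\<bar> \<le> b\<^sup>2))"

lemma jet_leE:
  assumes "jet_le I \<theta> F b"
  obtains G A where "hessian_at I \<theta> F G A"
    "\<forall>v. L2_set v I \<le> 1 \<longrightarrow> \<bar>\<Sum>i\<in>I. G \<theta> i * v i\<bar> \<le> b \<and>
       \<bar>\<Sum>i\<in>I. \<Sum>j\<in>I. v i * A i j * v j\<bar> \<le> b\<^sup>2"
  using assms unfolding jet_le_def by (elim exE conjE)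

lemma jet_leI:
  assumes "hessian_at I \<theta> F G A"
    and "\<And>v. L2_set v I \<le> 1 \<Longrightarrow> \<bar>\<Sum>i\<in>I. G \<theta> i * v i\<bar> \<le> b \<and>
       \<bar>\<Sum>i\<in>I. \<Sum>j\<in>I. v i * A i j * v j\<bar> \<le> b\<^sup>2"
  shows "jet_le I \<theta> F b"
  unfolding jet_le_def using assms by (intro exI[of _ G] exI[of _ A]) simp

lemma jet_le_nonneg:
  assumes "jet_le I \<theta> F b" shows "0 \<le> b"
proof -
  from assms obtain G A where "\<forall>v. L2_set v I \<le> 1 \<longrightarrow> \<bar>\<Sum>i\<in>I. G \<theta> i * v i\<bar> \<le> b \<and>
       \<bar>\<Sum>i\<in>I. \<Sum>j\<in>I. v i * A i j * v j\<bar> \<le> b\<^sup>2"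
    by (rule jet_leE)
  from this[rule_format, of "\<lambda>_. 0"] show ?thesis by (simp add: L2_set_def)
qed

lemma jet_le_point: "jet_le I \<theta> F b \<Longrightarrow> \<theta> \<in> I \<rightarrow>\<^sub>E UNIV"
  unfolding jet_le_def hessian_at_def by auto

lemma jet_le_mono:
  assumes F: "jet_le I \<theta> F b" and b: "b \<le> b'"
  shows "jet_le I \<theta> F b'"
proof -
  from F obtain G A where G: "hessian_at I \<theta> F G A"
    and B: "\<forall>v. L2_set v I \<le> 1 \<longrightarrow> \<bar>\<Sum>i\<in>I. G \<theta> i * v i\<bar> \<le> b \<and>
       \<bar>\<Sum>i\<in>I. \<Sum>j\<in>I. v i * A i j * v j\<bar> \<le> b\<^sup>2"
    by (rule jet_leE)
  have "b\<^sup>2 \<le> b'\<^sup>2" using b jet_le_nonneg[OF F] by (intro power_mono)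
  with B b show ?thesis by (intro jet_leI[OF G]) (meson order_trans)
qed

lemma jet_le_const: "\<theta> \<in> I \<rightarrow>\<^sub>E UNIV \<Longrightarrow> jet_le I \<theta> (\<lambda>_. k) 0"
  by (rule jet_leI[OF hessian_at_const]) auto

lemma jet_le_coord:
  assumes "finite I" "\<theta> \<in> I \<rightarrow>\<^sub>E UNIV" "p \<in> I"
  shows "jet_le I \<theta> (\<lambda>\<theta>. \<theta> p) 1"
proof -
  have "\<bar>\<Sum>i\<in>I. (if i = p then 1 else 0) * v i\<bar> \<le> 1" if "L2_set v I \<le> 1" for v
  proof -
    have "(\<Sum>i\<in>I. (if i = p then 1 else 0) * v i) = v p"
      using assms by (simp add: if_distrib[of "\<lambda>x. x * _"] cong: if_cong)
    moreover have "\<bar>v p\<bar> \<le> L2_set (\<lambda>i. \<bar>v i\<bar>) I" using assms by (intro member_le_L2_set) auto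
    moreover have "L2_set (\<lambda>i. \<bar>v i\<bar>) I = L2_set v I" by (simp add: L2_set_def)
    ultimately show ?thesis using that by simp
  qed
  thus ?thesis by (intro jet_leI[OF hessian_at_coord[OF assms]]) auto
qed

lemma jet_le_add:
  assumes fin: "finite I" and F: "jet_le I \<theta> F b" and F': "jet_le I \<theta> F' b'"
  shows "jet_le I \<theta> (\<lambda>\<theta>. F \<theta> + F' \<theta>) (b + b')"
proof -
  from F obtain G A where G: "hessian_at I \<theta> F G A"
    and B: "\<forall>v. L2_set v I \<le> 1 \<longrightarrow> \<bar>\<Sum>i\<in>I. G \<theta> i * v i\<bar> \<le> b \<and>
       \<bar>\<Sum>i\<in>I. \<Sum>j\<in>I. v i * A i j * v j\<bar> \<le> b\<^sup>2"
    by (rule jet_leE)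
  from F' obtain G' A' where G': "hessian_at I \<theta> F' G' A'"
    and B': "\<forall>v. L2_set v I \<le> 1 \<longrightarrow> \<bar>\<Sum>i\<in>I. G' \<theta> i * v i\<bar> \<le> b' \<and>
       \<bar>\<Sum>i\<in>I. \<Sum>j\<in>I. v i * A' i j * v j\<bar> \<le> b'\<^sup>2"
    by (rule jet_leE)
  have nn: "0 \<le> b" "0 \<le> b'" using F F' jet_le_nonneg by auto
  have "\<bar>\<Sum>i\<in>I. (G \<theta> i + G' \<theta> i) * v i\<bar> \<le> b + b' \<and>
    \<bar>\<Sum>i\<in>I. \<Sum>j\<in>I. v i * (A i j + A' i j) * v j\<bar> \<le> (b + b')\<^sup>2" if v: "L2_set v I \<le> 1" for v
  proof -
    have "(\<Sum>i\<in>I. (G \<theta> i + G' \<theta> i) * v i) = (\<Sum>i\<in>I. G \<theta> i * v i) + (\<Sum>i\<in>I. G' \<theta> i * v i)"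
      by (simp add: sum.distrib algebra_simps)
    moreover have "(\<Sum>i\<in>I. \<Sum>j\<in>I. v i * (A i j + A' i j) * v j)
      = (\<Sum>i\<in>I. \<Sum>j\<in>I. v i * A i j * v j) + (\<Sum>i\<in>I. \<Sum>j\<in>I. v i * A' i j * v j)"
      by (simp add: sum.distrib algebra_simps)
    moreover have "b\<^sup>2 + b'\<^sup>2 \<le> (b + b')\<^sup>2" using nn by (simp add: power2_sum)
    ultimately show ?thesis using B[rule_format, OF v] B'[rule_format, OF v] by auto
  qed
  thus ?thesis by (rule jet_leI[OF hessian_at_add[OF fin G G']])
qed

text \<open>Along \<open>v\<close> the second derivative is \<open>2 * g * g'\<close> plus the
  second derivatives of the factors, each weighted by the value of the other factor. Since
  \<open>a\<close> and \<open>a'\<close> are at least 1, these terms are dominated one by one by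
  those in the expansion of \<open>(a * b' + a' * b)\<^sup>2\<close>.\<close>

lemma jet_le_mult:
  assumes fin: "finite I" and F: "jet_le I \<theta> F b" and F': "jet_le I \<theta> F' b'"
    and a: "\<bar>F \<theta>\<bar> \<le> a" "1 \<le> a" and a': "\<bar>F' \<theta>\<bar> \<le> a'" "1 \<le> a'"
  shows "jet_le I \<theta> (\<lambda>\<theta>. F \<theta> * F' \<theta>) (a * b' + a' * b)"
proof -
  from F obtain G A where G: "hessian_at I \<theta> F G A"
    and B: "\<forall>v. L2_set v I \<le> 1 \<longrightarrow> \<bar>\<Sum>i\<in>I. G \<theta> i * v i\<bar> \<le> b \<and>
       \<bar>\<Sum>i\<in>I. \<Sum>j\<in>I. v i * A i j * v j\<bar> \<le> b\<^sup>2"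
    by (rule jet_leE)
  from F' obtain G' A' where G': "hessian_at I \<theta> F' G' A'"
    and B': "\<forall>v. L2_set v I \<le> 1 \<longrightarrow> \<bar>\<Sum>i\<in>I. G' \<theta> i * v i\<bar> \<le> b' \<and>
       \<bar>\<Sum>i\<in>I. \<Sum>j\<in>I. v i * A' i j * v j\<bar> \<le> b'\<^sup>2"
    by (rule jet_leE)
  have nn: "0 \<le> b" "0 \<le> b'" using F F' jet_le_nonneg by auto
  let ?A = "\<lambda>i j. (G \<theta> i * G' \<theta> j + F' \<theta> * A i j) + (G' \<theta> i * G \<theta> j + F \<theta> * A' i j)"
  have "\<bar>\<Sum>i\<in>I. (F' \<theta> * G \<theta> i + F \<theta> * G' \<theta> i) * v i\<bar> \<le> a * b' + a' * b \<and>
    \<bar>\<Sum>i\<in>I. \<Sum>j\<in>I. v i * ?A i j * v j\<bar> \<le> (a * b' + a' * b)\<^sup>2" if v: "L2_set v I \<le> 1" for v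
  proof -
    define g where "g = (\<Sum>i\<in>I. G \<theta> i * v i)"
    define g' where "g' = (\<Sum>i\<in>I. G' \<theta> i * v i)"
    define q where "q = (\<Sum>i\<in>I. \<Sum>j\<in>I. v i * A i j * v j)"
    define q' where "q' = (\<Sum>i\<in>I. \<Sum>j\<in>I. v i * A' i j * v j)"
    have gq: "\<bar>g\<bar> \<le> b" "\<bar>g'\<bar> \<le> b'" "\<bar>q\<bar> \<le> b\<^sup>2" "\<bar>q'\<bar> \<le> b'\<^sup>2"
      using B[rule_format, OF v] B'[rule_format, OF v] by (auto simp: g_def g'_def q_def q'_def)
    have 1: "(\<Sum>i\<in>I. (F' \<theta> * G \<theta> i + F \<theta> * G' \<theta> i) * v i) = F' \<theta> * g + F \<theta> * g'"
      unfolding g_def g'_def by (simp add: sum.distrib sum_distrib_left algebra_simps)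
    have "v i * ?A i j * v j = (G \<theta> i * v i) * (G' \<theta> j * v j) + (G' \<theta> i * v i) * (G \<theta> j * v j)
       + F' \<theta> * (v i * A i j * v j) + F \<theta> * (v i * A' i j * v j)" for i j
      by (simp add: algebra_simps)
    hence 2: "(\<Sum>i\<in>I. \<Sum>j\<in>I. v i * ?A i j * v j) = g * g' + g' * g + F' \<theta> * q + F \<theta> * q'"
      unfolding g_def g'_def q_def q'_def sum_product by (simp add: sum.distrib sum_distrib_left)
    have "\<bar>F' \<theta> * g\<bar> \<le> a' * b" "\<bar>F \<theta> * g'\<bar> \<le> a * b'" "\<bar>g * g'\<bar> \<le> b * b'"
      "\<bar>F' \<theta> * q\<bar> \<le> a' * b\<^sup>2" "\<bar>F \<theta> * q'\<bar> \<le> a * b'\<^sup>2"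
      unfolding abs_mult using a a' nn gq by (auto intro!: mult_mono)
    moreover have "a' * b\<^sup>2 \<le> a'\<^sup>2 * b\<^sup>2" "a * b'\<^sup>2 \<le> a\<^sup>2 * b'\<^sup>2"
      using a a' by (auto intro!: mult_right_mono self_le_power)
    moreover have "1 * (b * b') \<le> (a * a') * (b * b')"
      using a a' nn mult_mono[of 1 a 1 a'] by (intro mult_right_mono) auto
    moreover have "(a * b' + a' * b)\<^sup>2 = a\<^sup>2 * b'\<^sup>2 + a'\<^sup>2 * b\<^sup>2 + 2 * ((a * a') * (b * b'))"
      by (simp add: power2_eq_square algebra_simps)
    ultimately show ?thesis unfolding 1 2 by (auto simp: mult.commute)
  qed
  thus ?thesis by (rule jet_leI[OF hessian_at_mult[OF fin G G']])
qed

text \<open>Along \<open>v\<close> the second derivative is \<open>h2 * g\<^sup>2 + h' * q\<close>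
  with \<open>\<bar>g\<bar> \<le> b\<close> and \<open>\<bar>q\<bar> \<le> b\<^sup>2\<close>, hence
  the sum of both derivatives in the condition on \<open>K\<^sup>2\<close>.\<close>

lemma jet_le_comp:
  assumes fin: "finite I" and F: "jet_le I \<theta> F b" and e: "e > 0"
    and h: "\<And>y. \<bar>y - F \<theta>\<bar> < e \<Longrightarrow> (h has_real_derivative h' y) (at y)"
    and h': "(h' has_real_derivative h2) (at (F \<theta>))"
    and K: "\<bar>h' (F \<theta>)\<bar> \<le> K" "\<bar>h' (F \<theta>)\<bar> + \<bar>h2\<bar> \<le> K\<^sup>2"
  shows "jet_le I \<theta> (\<lambda>\<theta>. h (F \<theta>)) (K * b)"
proof -
  from F obtain G A where G: "hessian_at I \<theta> F G A"
    and B: "\<forall>v. L2_set v I \<le> 1 \<longrightarrow> \<bar>\<Sum>i\<in>I. G \<theta> i * v i\<bar> \<le> b \<and>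
       \<bar>\<Sum>i\<in>I. \<Sum>j\<in>I. v i * A i j * v j\<bar> \<le> b\<^sup>2"
    by (rule jet_leE)
  have nn: "0 \<le> b" using F jet_le_nonneg by auto
  let ?A = "\<lambda>i j. G \<theta> i * (h2 * G \<theta> j) + h' (F \<theta>) * A i j"
  have "\<bar>\<Sum>i\<in>I. (h' (F \<theta>) * G \<theta> i) * v i\<bar> \<le> K * b \<and>
    \<bar>\<Sum>i\<in>I. \<Sum>j\<in>I. v i * ?A i j * v j\<bar> \<le> (K * b)\<^sup>2" if v: "L2_set v I \<le> 1" for v
  proof -
    define g where "g = (\<Sum>i\<in>I. G \<theta> i * v i)"
    define q where "q = (\<Sum>i\<in>I. \<Sum>j\<in>I. v i * A i j * v j)"
    have gq: "\<bar>g\<bar> \<le> b" "\<bar>q\<bar> \<le> b\<^sup>2" using B[rule_format, OF v] by (auto simp: g_def q_def)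
    have 1: "(\<Sum>i\<in>I. (h' (F \<theta>) * G \<theta> i) * v i) = h' (F \<theta>) * g"
      unfolding g_def by (simp add: sum_distrib_left algebra_simps)
    have "v i * ?A i j * v j = h2 * ((G \<theta> i * v i) * (G \<theta> j * v j)) + h' (F \<theta>) * (v i * A i j * v j)" for i j
      by (simp add: algebra_simps)
    hence 2: "(\<Sum>i\<in>I. \<Sum>j\<in>I. v i * ?A i j * v j) = h2 * (g * g) + h' (F \<theta>) * q"
      unfolding g_def q_def sum_product by (simp add: sum.distrib sum_distrib_left)
    have "\<bar>h' (F \<theta>) * g\<bar> \<le> K * b" unfolding abs_mult using K gq nn by (auto intro!: mult_mono)
    moreover have "\<bar>g\<bar> * \<bar>g\<bar> \<le> b\<^sup>2"
      unfolding power2_eq_square by (intro mult_mono gq(1) nn abs_ge_zero)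
    hence "\<bar>h2\<bar> * (\<bar>g\<bar> * \<bar>g\<bar>) \<le> \<bar>h2\<bar> * b\<^sup>2" "\<bar>h' (F \<theta>)\<bar> * \<bar>q\<bar> \<le> \<bar>h' (F \<theta>)\<bar> * b\<^sup>2"
      using gq(2) by (auto intro!: mult_left_mono)
    hence "\<bar>h2 * (g * g)\<bar> \<le> \<bar>h2\<bar> * b\<^sup>2" "\<bar>h' (F \<theta>) * q\<bar> \<le> \<bar>h' (F \<theta>)\<bar> * b\<^sup>2"
      by (simp_all add: abs_mult)
    moreover have "(\<bar>h' (F \<theta>)\<bar> + \<bar>h2\<bar>) * b\<^sup>2 \<le> K\<^sup>2 * b\<^sup>2" using K by (intro mult_right_mono) auto
    ultimately show ?thesis unfolding 1 2 power_mult_distrib distrib_right by auto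
  qed
  moreover have "hessian_at I \<theta> (\<lambda>\<theta>. h (F \<theta>)) (\<lambda>\<theta> i. h' (F \<theta>) * G \<theta> i) ?A"
    by (rule hessian_at_comp[where F = F and \<theta> = \<theta> and h = h and h' = h', OF fin G e h h'])
  ultimately show ?thesis by (intro jet_leI[of I \<theta> _ "\<lambda>\<theta> i. h' (F \<theta>) * G \<theta> i" ?A]) blast+
qed

text \<open>Second derivatives scale by \<open>k\<close> and not by \<open>k\<^sup>2\<close>, so a
  small \<open>k\<close> does not shrink the bound accordingly; with \<open>1 \<le> K\<close> one
  has \<open>\<bar>k\<bar> \<le> K \<le> K\<^sup>2\<close>.\<close>

lemma jet_le_scale:
  assumes fin: "finite I" and F: "jet_le I \<theta> F b" and k: "\<bar>k\<bar> \<le> K" "1 \<le> K"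
  shows "jet_le I \<theta> (\<lambda>\<theta>. k * F \<theta>) (K * b)"
proof -
  have "jet_le I \<theta> (\<lambda>\<theta>. (\<lambda>x. k * x) (F \<theta>)) (K * b)"
  proof (rule jet_le_comp[where F = F and h = "\<lambda>x. k * x" and h' = "\<lambda>_. k" and e = 1 and ?h2.0 = 0, OF fin F])
    show "((*) k has_real_derivative k) (at y)" for y
      using DERIV_cmult[OF DERIV_ident, of k y UNIV] by simp
    show "\<bar>k\<bar> + \<bar>0\<bar> \<le> K\<^sup>2" using k self_le_power[of K 2] by simp
  qed (use k in auto)
  thus ?thesis by simp
qed

lemma jet_le_diff:
  assumes fin: "finite I" and F: "jet_le I \<theta> F b" and G: "jet_le I \<theta> G b'"
  shows "jet_le I \<theta> (\<lambda>\<theta>. F \<theta> - G \<theta>) (b + b')"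
  using jet_le_add[OF fin F jet_le_scale[OF fin G, of "-1" 1]] by simp

lemma jet_le_sum:
  assumes fin: "finite I" and \<theta>: "\<theta> \<in> I \<rightarrow>\<^sub>E UNIV" and F: "\<And>s. s \<in> S \<Longrightarrow> jet_le I \<theta> (F s) b"
  shows "jet_le I \<theta> (\<lambda>\<theta>. \<Sum>s\<in>S. F s \<theta>) (real (card S) * b)"
  using F
proof (induction S rule: infinite_finite_induct)
  case (insert x S)
  have "jet_le I \<theta> (\<lambda>\<theta>. F x \<theta> + (\<Sum>s\<in>S. F s \<theta>)) (b + real (card S) * b)"
    using insert by (intro jet_le_add fin) auto
  thus ?case using insert by (simp add: algebra_simps)
qed (auto simp: jet_le_const[OF \<theta>])

text \<open>Scaling and adding would cost a factor of the cardinality, because the scaling rule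
  gains nothing from weights below 1. Averaging the first and second derivatives directly keeps
  \<open>b\<close> unchanged.\<close>

lemma jet_le_convex:
  assumes fin: "finite I" and S: "finite S" and w: "\<And>s. s \<in> S \<Longrightarrow> 0 \<le> w s" "sum w S = 1"
    and F: "\<And>s. s \<in> S \<Longrightarrow> jet_le I \<theta> (F s) b"
  shows "jet_le I \<theta> (\<lambda>\<theta>. \<Sum>s\<in>S. w s * F s \<theta>) b"
proof -
  have "S \<noteq> {}" using w(2) by auto
  then obtain s0 where "s0 \<in> S" by blast
  hence \<theta>: "\<theta> \<in> I \<rightarrow>\<^sub>E UNIV" and b: "0 \<le> b" using jet_le_point[OF F] jet_le_nonneg[OF F] by auto
  \<comment> \<open>For a partial sum of total weight below 1, the second-order bound (weight times
    \<open>b\<^sup>2\<close>) may exceed the square of the first-order bound (weight times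
    \<open>b\<close>). The induction therefore tracks both; they fit together again at total weight
    1.\<close>
  have "\<exists>G A. hessian_at I \<theta> (\<lambda>\<theta>. \<Sum>s\<in>S'. w s * F s \<theta>) G A \<and> (\<forall>v. L2_set v I \<le> 1 \<longrightarrow>
      \<bar>\<Sum>i\<in>I. G \<theta> i * v i\<bar> \<le> sum w S' * b \<and>
      \<bar>\<Sum>i\<in>I. \<Sum>j\<in>I. v i * A i j * v j\<bar> \<le> sum w S' * b\<^sup>2)" if "S' \<subseteq> S" for S'
    using finite_subset[OF that S] that
  proof (induction S' rule: finite_induct)
    case empty
    show ?case using hessian_at_const[OF \<theta>, of 0]
      by (intro exI[of _ "\<lambda>_ _. 0"]) auto
  next
    case (insert x S')
    then obtain G A where G: "hessian_at I \<theta> (\<lambda>\<theta>. \<Sum>s\<in>S'. w s * F s \<theta>) G A"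
      and B: "\<forall>v. L2_set v I \<le> 1 \<longrightarrow>
        \<bar>\<Sum>i\<in>I. G \<theta> i * v i\<bar> \<le> sum w S' * b \<and>
        \<bar>\<Sum>i\<in>I. \<Sum>j\<in>I. v i * A i j * v j\<bar> \<le> sum w S' * b\<^sup>2"
      by auto
    have x: "x \<in> S" using insert by simp
    from F[OF x] obtain G' A' where G': "hessian_at I \<theta> (F x) G' A'"
      and B': "\<forall>v. L2_set v I \<le> 1 \<longrightarrow> \<bar>\<Sum>i\<in>I. G' \<theta> i * v i\<bar> \<le> b \<and>
       \<bar>\<Sum>i\<in>I. \<Sum>j\<in>I. v i * A' i j * v j\<bar> \<le> b\<^sup>2"
      by (rule jet_leE)
    note H = hessian_at_add[OF fin hessian_at_mult[OF fin hessian_at_const[OF \<theta>, of "w x"] G'] G]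
    show ?case
    proof (intro exI conjI allI impI)
      show "hessian_at I \<theta> (\<lambda>\<theta>. \<Sum>s\<in>insert x S'. w s * F s \<theta>)
        (\<lambda>\<theta> i. w x * G' \<theta> i + G \<theta> i) (\<lambda>i j. w x * A' i j + A i j)"
        using H insert by simp
      fix v assume v: "L2_set v I \<le> 1"
      have 1: "(\<Sum>i\<in>I. (w x * G' \<theta> i + G \<theta> i) * v i) = w x * (\<Sum>i\<in>I. G' \<theta> i * v i) + (\<Sum>i\<in>I. G \<theta> i * v i)"
        by (simp add: sum.distrib sum_distrib_left algebra_simps)
      have 2: "(\<Sum>i\<in>I. \<Sum>j\<in>I. v i * (w x * A' i j + A i j) * v j)
        = w x * (\<Sum>i\<in>I. \<Sum>j\<in>I. v i * A' i j * v j) + (\<Sum>i\<in>I. \<Sum>j\<in>I. v i * A i j * v j)"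
        by (simp add: sum.distrib sum_distrib_left algebra_simps)
      have "\<bar>w x * (\<Sum>i\<in>I. G' \<theta> i * v i)\<bar> \<le> w x * b"
        "\<bar>w x * (\<Sum>i\<in>I. \<Sum>j\<in>I. v i * A' i j * v j)\<bar> \<le> w x * b\<^sup>2"
        unfolding abs_mult using B'[rule_format, OF v] w(1)[OF x] by (auto intro!: mult_mono)
      moreover have "sum w (insert x S') = w x + sum w S'" using insert by simp
      ultimately show "\<bar>\<Sum>i\<in>I. (w x * G' \<theta> i + G \<theta> i) * v i\<bar> \<le> sum w (insert x S') * b"
        "\<bar>\<Sum>i\<in>I. \<Sum>j\<in>I. v i * (w x * A' i j + A i j) * v j\<bar> \<le> sum w (insert x S') * b\<^sup>2"
        unfolding 1 2 using B[rule_format, OF v] by (auto simp: distrib_right)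
    qed
  qed
  from this[OF subset_refl] obtain G A where "hessian_at I \<theta> (\<lambda>\<theta>. \<Sum>s\<in>S. w s * F s \<theta>) G A"
    and "\<forall>v. L2_set v I \<le> 1 \<longrightarrow> \<bar>\<Sum>i\<in>I. G \<theta> i * v i\<bar> \<le> b \<and>
      \<bar>\<Sum>i\<in>I. \<Sum>j\<in>I. v i * A i j * v j\<bar> \<le> b\<^sup>2"
    using w by auto
  thus ?thesis by (intro jet_leI[of I \<theta> _ G A]) auto
qed

section \<open>Matrix products and RMS normalisation\<close>

lemma jet_le_matvec:
  assumes fin: "finite I" and \<theta>: "\<theta> \<in> I \<rightarrow>\<^sub>E UNIV" and a: "1 \<le> a" and r: "1 \<le> r" and b: "0 \<le> b"
    and W: "\<And>j. j < n \<Longrightarrow> jet_le I \<theta> (\<lambda>\<theta>. W \<theta> i j) 1" "\<And>j. j < n \<Longrightarrow> \<bar>W \<theta> i j\<bar> \<le> r"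
    and x: "\<And>j. j < n \<Longrightarrow> jet_le I \<theta> (\<lambda>\<theta>. x \<theta> j) b" "\<And>j. j < n \<Longrightarrow> \<bar>x \<theta> j\<bar> \<le> a"
  shows "jet_le I \<theta> (\<lambda>\<theta>. matvec n (W \<theta>) (x \<theta>) i) (n * (r * b + a))"
proof -
  have "jet_le I \<theta> (\<lambda>\<theta>. W \<theta> i j * x \<theta> j) (r * b + a)" if "j < n" for j
  proof -
    have "jet_le I \<theta> (\<lambda>\<theta>. W \<theta> i j * x \<theta> j) (r * b + a * 1)"
      by (rule jet_le_mult[OF fin]) (use W x a r that in auto)
    thus ?thesis by simp
  qed
  hence "jet_le I \<theta> (\<lambda>\<theta>. \<Sum>j\<in>{..<n}. W \<theta> i j * x \<theta> j) (real (card {..<n}) * (r * b + a))"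
    by (intro jet_le_sum[OF fin \<theta>]) auto
  thus ?thesis by (simp add: matvec_def)
qed

lemma abs_matvec_le:
  assumes "\<And>j. j < n \<Longrightarrow> \<bar>W i j\<bar> \<le> r" "\<And>j. j < n \<Longrightarrow> \<bar>x j\<bar> \<le> a"
  shows "\<bar>matvec n W x i\<bar> \<le> n * (r * a)"
proof -
  have "\<bar>matvec n W x i\<bar> \<le> (\<Sum>j<n. \<bar>W i j * x j\<bar>)" unfolding matvec_def by (rule sum_abs)
  also have "\<dots> \<le> (\<Sum>j<n. r * a)"
    unfolding abs_mult using assms by (intro sum_mono mult_mono) (auto intro: order_trans[OF abs_ge_zero])
  finally show ?thesis by simp
qed

lemma abs_rmsnorm_le:
  assumes "0 < eps" "i < k"
  shows "\<bar>rmsnorm eps k x i\<bar> \<le> k"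
proof -
  let ?m = "1 / real k * (\<Sum>j<k. (x j)\<^sup>2) + eps"
  have "(x i)\<^sup>2 \<le> (\<Sum>j<k. (x j)\<^sup>2)" using assms by (intro member_le_sum) auto
  also have "\<dots> = k * (1 / real k * (\<Sum>j<k. (x j)\<^sup>2))" using assms by simp
  also have "\<dots> \<le> k * ?m" using assms by (intro mult_left_mono) auto
  \<comment> \<open>The line above already gives the bound \<open>sqrt k\<close>. As
    \<open>k\<close> is at least 1, it is rounded up to \<open>k\<close> to keep roots out of the
    constants.\<close>
  also have "\<dots> \<le> (real k)\<^sup>2 * ?m"
    using assms by (intro mult_right_mono self_le_power add_nonneg_nonneg mult_nonneg_nonneg sum_nonneg) auto
  finally have "sqrt ((x i)\<^sup>2) \<le> sqrt ((real k)\<^sup>2 * ?m)" by (rule real_sqrt_le_mono)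
  hence "\<bar>x i\<bar> \<le> k * sqrt ?m" by (simp add: real_sqrt_mult)
  moreover have "0 < ?m" using assms by (intro add_nonneg_pos mult_nonneg_nonneg sum_nonneg) auto
  ultimately show ?thesis by (simp add: rmsnorm_def abs_divide divide_le_eq)
qed

text \<open>The maximum bounds the factor by which the input is rescaled. The summand
  \<open>4 * (real k)\<^sup>2\<close> comes from differentiating the inverse square root, the
  summand 1 from differentiating the numerator.\<close>

definition rms_const :: "real \<Rightarrow> nat \<Rightarrow> real" where
  "rms_const eps k = (4 * (real k)\<^sup>2 + 1) * max 1 (1 / sqrt eps)"

lemma rms_const_ge_1: "1 \<le> rms_const eps k"
  unfolding rms_const_def using mult_mono[of 1 "4 * (real k)\<^sup>2 + 1" 1 "max 1 (1 / sqrt eps)"] by auto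

text \<open>
  Dividing the input by the constant \<open>s = sqrt (|x \<theta>|\<^sup>2 / k + eps)\<close> reduces to the case where the radicand
  equals 1 at \<open>\<theta>\<close>, so that no bound on \<open>x \<theta>\<close> is needed.
\<close>

lemma jet_le_rmsnorm:
  assumes fin: "finite I" and \<theta>: "\<theta> \<in> I \<rightarrow>\<^sub>E UNIV" and eps: "0 < eps" and i: "i < k"
    and x: "\<And>j. j < k \<Longrightarrow> jet_le I \<theta> (\<lambda>\<theta>. x \<theta> j) b"
  shows "jet_le I \<theta> (\<lambda>\<theta>. rmsnorm eps k (x \<theta>) i) (rms_const eps k * b)"
proof -
  define m where "m = (\<lambda>\<theta>. 1 / real k * (\<Sum>j<k. (x \<theta> j)\<^sup>2) + eps)"
  define s where "s = sqrt (m \<theta>)"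
  define c where "c = max 1 (1 / sqrt eps)"
  define y where "y = (\<lambda>\<theta> j. 1 / s * x \<theta> j)"
  define Y where "Y = (\<lambda>\<theta>. (\<Sum>j<k. 1 / real k * (y \<theta> j * y \<theta> j)) + eps / s\<^sup>2)"
  have k: "1 \<le> real k" using i by simp
  have b: "0 \<le> b" using jet_le_nonneg[OF x[OF i]] .
  have m: "eps \<le> m p" for p unfolding m_def by (simp add: sum_nonneg)
  have s: "sqrt eps \<le> s" "0 < s" "s\<^sup>2 = m \<theta>"
    using m[of \<theta>] eps by (auto simp: s_def)
  have Yeq: "Y p = m p / s\<^sup>2" for p
  proof -
    have "1 / real k * (y p j * y p j) = 1 / real k * (x p j)\<^sup>2 / s\<^sup>2" for j
      by (simp add: y_def power2_eq_square)
    thus ?thesis by (simp add: Y_def m_def add_divide_distrib sum_distrib_left sum_divide_distrib)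
  qed
  have Y1: "Y \<theta> = 1" unfolding Yeq s(3) using m[of \<theta>] eps by simp
  have c: "1 \<le> c" "1 / s \<le> c"
    using s eps by (auto simp: c_def intro!: le_max_iff_disj[THEN iffD2] disjI2 divide_left_mono)
  have yj: "jet_le I \<theta> (\<lambda>\<theta>. y \<theta> j) (c * b)" if "j < k" for j
    unfolding y_def using jet_le_scale[OF fin x[OF that], of "1 / s" c] s(2) c by simp
  \<comment> \<open>At \<theta> the vector \<open>y\<close> coincides with the normalised vector,
    hence is bounded by \<open>k\<close> whatever the size of \<open>x\<close>.\<close>
  have ya: "\<bar>y \<theta> j\<bar> \<le> k" if "j < k" for j
    using abs_rmsnorm_le[OF eps that, of "x \<theta>"] unfolding rmsnorm_def y_def s_def m_def by simp
  have "jet_le I \<theta> (\<lambda>\<theta>. y \<theta> j * y \<theta> j) (k * (c * b) + k * (c * b))" if "j < k" for j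
    by (rule jet_le_mult[OF fin]) (use yj ya k that in auto)
  \<comment> \<open>The mean square is a convex combination with weights \<open>1 / k\<close>, so
    the summation costs no further factor \<open>k\<close>.\<close>
  hence "jet_le I \<theta> (\<lambda>\<theta>. \<Sum>j\<in>{..<k}. 1 / real k * (y \<theta> j * y \<theta> j)) (k * (c * b) + k * (c * b))"
    using i by (intro jet_le_convex[OF fin]) auto
  hence "jet_le I \<theta> Y (k * (c * b) + k * (c * b) + 0)"
    unfolding Y_def by (intro jet_le_add[OF fin] jet_le_const[OF \<theta>])
  hence Y: "jet_le I \<theta> Y (2 * k * c * b)" by (simp add: algebra_simps)
  have D: "((\<lambda>z. z powr (-1/2)) has_real_derivative (-1/2) * z powr (-3/2)) (at z)" if "z > 0" for z :: real
    using that by (auto intro!: derivative_eq_intros simp: powr_diff[symmetric])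
  have D2: "((\<lambda>z. (-1/2) * z powr (-3/2)) has_real_derivative 3/4) (at (1::real))"
    by (auto intro!: derivative_eq_intros)
  \<comment> \<open>At 1 the derivatives of \<open>z powr (-1/2)\<close> are -1/2 and 3/4, and 1/2 +
    3/4 is at most 4, the square of the factor 2. Radius 1 around \<open>Y \<theta> = 1\<close>
    keeps the argument positive.\<close>
  have h: "jet_le I \<theta> (\<lambda>\<theta>. (\<lambda>z. z powr (-1/2)) (Y \<theta>)) (2 * (2 * k * c * b))"
    by (rule jet_le_comp[where F = Y and h = "\<lambda>z. z powr (-1/2)" and h' = "\<lambda>z. (-1/2) * z powr (-3/2)"
          and e = 1 and ?h2.0 = "3/4", OF fin Y]) (use D D2 Y1 in auto)
  have "jet_le I \<theta> (\<lambda>\<theta>. y \<theta> i * (Y \<theta> powr (-1/2))) (k * (2 * (2 * k * c * b)) + 1 * (c * b))"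
    by (rule jet_le_mult[OF fin]) (use yj[OF i] h ya[OF i] k Y1 in auto)
  moreover have "y p i * (Y p powr (-1/2)) = rmsnorm eps k (x p) i" for p
  proof -
    have "Y p powr (-1/2) = 1 / sqrt (m p / s\<^sup>2)"
      using m[of p] eps s(2) unfolding Yeq by (simp add: powr_minus_divide powr_half_sqrt)
    also have "\<dots> = s / sqrt (m p)" using s(2) by (simp add: real_sqrt_divide)
    finally show ?thesis using s(2) by (simp add: y_def rmsnorm_def m_def)
  qed
  ultimately have "jet_le I \<theta> (\<lambda>\<theta>. rmsnorm eps k (x \<theta>) i) (k * (2 * (2 * k * c * b)) + 1 * (c * b))"
    by simp
  thus ?thesis by (simp add: rms_const_def c_def[symmetric] power2_eq_square algebra_simps)
qed

section \<open>Softmax averages and log-sum-exp\<close>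

text \<open>With the value at \<theta> subtracted, the exponential and its first two derivatives
  equal 1 there, so the size of \<open>F \<theta>\<close> does not enter. The factor 2 works since 1
  + 1 is at most 4.\<close>

lemma jet_le_exp_shift:
  assumes fin: "finite I" and F: "jet_le I \<theta> F b"
  shows "jet_le I \<theta> (\<lambda>\<theta>'. exp (F \<theta>' - F \<theta>)) (2 * b)"
proof (rule jet_le_comp[where F = F and h = "\<lambda>z. exp (z - F \<theta>)" and h' = "\<lambda>z. exp (z - F \<theta>)"
      and e = 1 and ?h2.0 = 1, OF fin F])
  have D: "((\<lambda>z. exp (z - F \<theta>)) has_real_derivative exp (y - F \<theta>)) (at y)" for y
    by (auto intro!: derivative_eq_intros)
  show "((\<lambda>z. exp (z - F \<theta>)) has_real_derivative exp (y - F \<theta>)) (at y)" for y by (rule D)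
  show "((\<lambda>z. exp (z - F \<theta>)) has_real_derivative 1) (at (F \<theta>))" using D[of "F \<theta>"] by simp
qed auto

text \<open>The weights on the right are frozen at the reference point \<open>z\<close>; only ratios
  of exponentials vary. With \<open>v\<close> constantly 1 this rewrites the normalising sum
  itself.\<close>

lemma exp_sum_shift:
  assumes "finite S" "S \<noteq> {}"
  shows "(\<Sum>s\<in>S. exp (a s) * v s) =
    (\<Sum>j\<in>S. exp (z j)) * (\<Sum>s\<in>S. softmax S z s * (exp (a s - z s) * v s :: real))"
proof -
  have "(\<Sum>j\<in>S. exp (z j)) > 0" using assms by (intro sum_pos) auto
  thus ?thesis by (simp add: sum_distrib_left softmax_def exp_diff)
qed

lemma softmax_nonneg: "0 \<le> softmax S z s"
  by (simp add: softmax_def sum_nonneg)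

lemma sum_softmax:
  assumes "finite S" "S \<noteq> {}" shows "sum (softmax S z) S = 1"
proof -
  have "(\<Sum>j\<in>S. exp (z j)) > 0" using assms by (intro sum_pos) auto
  thus ?thesis by (simp add: softmax_def[abs_def] flip: sum_divide_distrib)
qed

lemma abs_softmax_average_le:
  assumes "finite S" "S \<noteq> {}" "\<And>s. s \<in> S \<Longrightarrow> \<bar>v s\<bar> \<le> \<alpha>"
  shows "\<bar>\<Sum>s\<in>S. softmax S z s * v s\<bar> \<le> \<alpha>"
proof -
  have "\<bar>\<Sum>s\<in>S. softmax S z s * v s\<bar> \<le> (\<Sum>s\<in>S. \<bar>softmax S z s * v s\<bar>)" by (rule sum_abs)
  also have "\<dots> \<le> (\<Sum>s\<in>S. softmax S z s * \<alpha>)"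
    using assms by (intro sum_mono) (auto simp: abs_mult softmax_nonneg intro!: mult_left_mono)
  also have "\<dots> = \<alpha>" using sum_softmax[OF assms(1,2), of z] by (simp flip: sum_distrib_right)
  finally show ?thesis .
qed

text \<open>
  Numerator and denominator of a softmax average, divided by the normalising constant at \<open>\<theta>\<close>, are
  convex combinations over \<open>S\<close>. This makes the bounds independent of the cardinality of \<open>S\<close>.
\<close>

lemma jet_le_softmax_average:
  assumes fin: "finite I" and S: "finite S" "S \<noteq> {}"
    and a: "\<And>s. s \<in> S \<Longrightarrow> jet_le I \<theta> (\<lambda>\<theta>. a \<theta> s) b"
    and v: "\<And>s. s \<in> S \<Longrightarrow> jet_le I \<theta> (\<lambda>\<theta>. v \<theta> s) \<beta>" "\<And>s. s \<in> S \<Longrightarrow> \<bar>v \<theta> s\<bar> \<le> \<alpha>"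
    and \<alpha>: "1 \<le> \<alpha>"
  shows "jet_le I \<theta> (\<lambda>\<theta>. \<Sum>s\<in>S. softmax S (a \<theta>) s * v \<theta> s) (\<beta> + 6 * \<alpha> * b)"
proof -
  define num where "num = (\<lambda>p. \<Sum>s\<in>S. softmax S (a \<theta>) s * (exp (a p s - a \<theta> s) * v p s))"
  define den where "den = (\<lambda>p. \<Sum>s\<in>S. softmax S (a \<theta>) s * exp (a p s - a \<theta> s))"
  have E: "jet_le I \<theta> (\<lambda>p. exp (a p s - a \<theta> s)) (2 * b)" if "s \<in> S" for s
    using jet_le_exp_shift[OF fin a[OF that]] .
  have num: "jet_le I \<theta> num (1 * \<beta> + \<alpha> * (2 * b))"
    unfolding num_def
  proof (rule jet_le_convex[OF fin S(1) softmax_nonneg sum_softmax[OF S]])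
    fix s assume "s \<in> S"
    thus "jet_le I \<theta> (\<lambda>p. exp (a p s - a \<theta> s) * v p s) (1 * \<beta> + \<alpha> * (2 * b))"
      by (intro jet_le_mult[OF fin] E v \<alpha>) auto
  qed
  have den: "jet_le I \<theta> den (2 * b)"
    unfolding den_def by (rule jet_le_convex[OF fin S(1) softmax_nonneg sum_softmax[OF S] E])
  have den1: "den \<theta> = 1" using sum_softmax[OF S, of "a \<theta>"] by (simp add: den_def)
  \<comment> \<open>At 1 the derivatives of the reciprocal are -1 and 2, and 1 + 2 is at most 4.
    Radius 1 excludes the pole at 0.\<close>
  have inv: "jet_le I \<theta> (\<lambda>p. inverse (den p)) (2 * (2 * b))"
  proof (rule jet_le_comp[where F = den and h = inverse and h' = "\<lambda>z. - inverse (z\<^sup>2)" and e = 1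
        and ?h2.0 = 2, OF fin den])
    fix y assume "\<bar>y - den \<theta>\<bar> < 1"
    hence "y \<noteq> 0" using den1 by auto
    thus "(inverse has_real_derivative - inverse (y\<^sup>2)) (at y)"
      by (auto intro!: derivative_eq_intros simp: power2_eq_square)
  qed (auto intro!: derivative_eq_intros simp: den1 power2_eq_square)
  have "\<bar>num \<theta>\<bar> \<le> \<alpha>" unfolding num_def using v by (auto intro!: abs_softmax_average_le S)
  \<comment> \<open>At \<theta> the numerator is at most \<alpha> and the reciprocal is 1. The
    reciprocal thus contributes \<open>4 * \<alpha> * b\<close> and the numerator
    \<open>\<beta> + 2 * \<alpha> * b\<close>.\<close>
  hence "jet_le I \<theta> (\<lambda>p. num p * inverse (den p)) (\<alpha> * (2 * (2 * b)) + 1 * (1 * \<beta> + \<alpha> * (2 * b)))"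
    by (intro jet_le_mult[OF fin num inv] \<alpha>) (auto simp: den1)
  moreover have "(\<Sum>s\<in>S. softmax S (a p) s * v p s) = num p * inverse (den p)" for p
  proof -
    have "(\<Sum>j\<in>S. exp (a \<theta> j)) > 0" using S by (intro sum_pos) auto
    moreover have "(\<Sum>s\<in>S. softmax S (a p) s * v p s) = (\<Sum>s\<in>S. exp (a p s) * v p s) / (\<Sum>s\<in>S. exp (a p s) * 1)"
      by (simp add: softmax_def sum_divide_distrib)
    ultimately show ?thesis unfolding exp_sum_shift[OF S, where z = "a \<theta>"] num_def den_def
      by (simp add: divide_inverse)
  qed
  ultimately show ?thesis by (simp add: algebra_simps)
qed

text \<open>Up to an additive constant this is the logarithm of a convex combination that equals 1
  at \<theta>. Hence the bound does not involve the number of logits.\<close>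

lemma jet_le_log_sum_exp:
  fixes S :: "nat set"
  assumes fin: "finite I" and S: "finite S" "S \<noteq> {}"
    and a: "\<And>s. s \<in> S \<Longrightarrow> jet_le I \<theta> (\<lambda>\<theta>. a \<theta> s) b"
  shows "jet_le I \<theta> (\<lambda>\<theta>. ln (\<Sum>s\<in>S. exp (a \<theta> s))) (4 * b)"
proof -
  define den where "den = (\<lambda>p. \<Sum>s\<in>S. softmax S (a \<theta>) s * exp (a p s - a \<theta> s))"
  have den: "jet_le I \<theta> den (2 * b)"
    unfolding den_def by (rule jet_le_convex[OF fin S(1) softmax_nonneg sum_softmax[OF S]])
      (rule jet_le_exp_shift[OF fin a])
  have den1: "den \<theta> = 1" using sum_softmax[OF S, of "a \<theta>"] by (simp add: den_def)
  have "jet_le I \<theta> (\<lambda>p. ln (den p)) (2 * (2 * b))"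
  proof (rule jet_le_comp[where F = den and h = ln and h' = "\<lambda>z. inverse z" and e = 1
        and ?h2.0 = "-1", OF fin den])
    fix y assume "\<bar>y - den \<theta>\<bar> < 1"
    hence "y > 0" using den1 by auto
    thus "(ln has_real_derivative inverse y) (at y)"
      by (rule DERIV_ln)
  qed (auto intro!: derivative_eq_intros simp: den1 power2_eq_square)
  hence 1: "jet_le I \<theta> (\<lambda>p. ln (\<Sum>s\<in>S. exp (a \<theta> s)) + ln (den p)) (0 + 2 * (2 * b))"
    by (intro jet_le_add[OF fin] jet_le_const[OF jet_le_point[OF den]])
  have eq: "ln (\<Sum>s\<in>S. exp (a p s)) = ln (\<Sum>s\<in>S. exp (a \<theta> s)) + ln (den p)" for p
  proof -
    have pos: "(\<Sum>s\<in>S. exp (q s)) > 0" for q :: "nat \<Rightarrow> real" using S by (intro sum_pos) auto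
    have eq: "(\<Sum>s\<in>S. exp (a p s)) = (\<Sum>s\<in>S. exp (a \<theta> s)) * den p"
      using exp_sum_shift[OF S, of "a p" "\<lambda>_. 1" "a \<theta>"] by (simp add: den_def)
    have "den p > 0" using zero_less_mult_pos[OF _ pos[of "a \<theta>"], of "den p"] pos[of "a p"] eq by simp
    thus ?thesis unfolding eq by (rule ln_mult_pos[OF pos])
  qed
  hence "(\<lambda>p. ln (\<Sum>s\<in>S. exp (a p s))) = (\<lambda>p. ln (\<Sum>s\<in>S. exp (a \<theta> s)) + ln (den p))"
    by (rule ext)
  with 1 show ?thesis by (simp only:) (simp add: mult.assoc[symmetric])
qed

section \<open>Squared ReLU and softcap\<close>

text \<open>Within distance \<open>\<bar>F \<theta>\<bar>\<close> of the nonzero value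
  \<open>F \<theta>\<close> the sign does not change, so the function is there either the square or
  zero.\<close>

lemma jet_le_sqrelu:
  assumes fin: "finite I" and F: "jet_le I \<theta> F b" and a: "\<bar>F \<theta>\<bar> \<le> a" "1 \<le> a" and nz: "F \<theta> \<noteq> 0"
  shows "jet_le I \<theta> (\<lambda>\<theta>. sqrelu (F \<theta>)) (3 * a * b)"
proof -
  have s: "eventually (\<lambda>z. sgn z = sgn y) (nhds y)" if "y \<noteq> 0" for y :: real
  proof (cases "y > 0")
    case True
    thus ?thesis using eventually_nhds_in_open[of "{0<..}" y] by (auto elim!: eventually_mono)
  next
    case False
    thus ?thesis using eventually_nhds_in_open[of "{..<0}" y] that by (auto elim!: eventually_mono)
  qed
  let ?h2 = "if F \<theta> > 0 then 2 else 0 :: real"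
  \<comment> \<open>The first derivative is at most \<open>2 * a\<close> and the second at most 2;
    their sum has to stay below the square of the factor \<open>3 * a\<close>.\<close>
  have a2: "2 * a + 2 \<le> (3 * a)\<^sup>2"
  proof -
    have "a \<le> a * a" using a(2) mult_right_mono[of 1 a a] by simp
    hence "2 * a + 2 \<le> 9 * (a * a)" using a(2) by linarith
    thus ?thesis by (simp add: power2_eq_square)
  qed
  show ?thesis
  proof (rule jet_le_comp[where F = F and h = sqrelu and h' = "\<lambda>z. 2 * max z 0" and e = "\<bar>F \<theta>\<bar>"
        and ?h2.0 = ?h2, OF fin F])
    fix y assume "\<bar>y - F \<theta>\<bar> < \<bar>F \<theta>\<bar>"
    hence y: "y \<noteq> 0" by auto
    have "((\<lambda>z. if y > 0 then z\<^sup>2 else 0) has_real_derivative 2 * max y 0) (at y)"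
      using y by (cases "y > 0") (auto intro!: derivative_eq_intros)
    moreover have ev: "eventually (\<lambda>z. (if y > 0 then z\<^sup>2 else 0) = sqrelu z) (nhds y)"
      using s[OF y] by eventually_elim (auto simp: sqrelu_def sgn_if split: if_splits)
    ultimately show "(sqrelu has_real_derivative 2 * max y 0) (at y)"
      by (simp only: DERIV_cong_ev[OF refl ev refl])
  next
    have "((\<lambda>z. if F \<theta> > 0 then 2 * z else 0) has_real_derivative ?h2) (at (F \<theta>))"
      by (cases "F \<theta> > 0") (auto intro!: derivative_eq_intros)
    moreover have ev: "eventually (\<lambda>z. (if F \<theta> > 0 then 2 * z else 0) = 2 * max z 0) (nhds (F \<theta>))"
      using s[OF nz] by eventually_elim (auto simp: sgn_if split: if_splits)
    ultimately show "((\<lambda>z. 2 * max z 0) has_real_derivative ?h2) (at (F \<theta>))"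
      by (simp only: DERIV_cong_ev[OF refl ev refl])
  qed (use nz a a2 in \<open>auto simp: max_def\<close>)
qed

lemma abs_sqrelu_le: "\<bar>z\<bar> \<le> a \<Longrightarrow> \<bar>sqrelu z\<bar> \<le> a\<^sup>2"
  unfolding sqrelu_def using power_mono[of "max z 0" a 2] by auto

text \<open>The first two derivatives are bounded globally, by 1 and \<open>2 / tau\<close>, so the
  uncapped logit may be arbitrarily large. The factor \<open>1 + 2 / tau\<close> is at least 1, so
  its square dominates their sum.\<close>

lemma jet_le_softcap:
  assumes fin: "finite I" and F: "jet_le I \<theta> F b" and tau: "0 < tau"
  shows "jet_le I \<theta> (\<lambda>\<theta>. softcap tau (F \<theta>)) ((1 + 2 / tau) * b)"
proof -
  define u where "u = tanh (F \<theta> / tau)"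
  have u: "\<bar>u\<bar> \<le> 1" "0 \<le> 1 - u\<^sup>2" "1 - u\<^sup>2 \<le> 1"
    using tanh_real_bounds[of "F \<theta> / tau"] by (auto simp: u_def abs_square_le_1)
  define h2 where "h2 = - 2 * u * (1 - u\<^sup>2) / tau"
  have "\<bar>u\<bar> * (1 - u\<^sup>2) \<le> 1" using u by (intro mult_le_one) auto
  hence h2: "\<bar>h2\<bar> \<le> 2 / tau"
    using tau u divide_right_mono[of "2 * (\<bar>u\<bar> * (1 - u\<^sup>2))" 2 tau] by (simp add: h2_def abs_mult mult.assoc)
  have K: "1 + 2 / tau \<le> (1 + 2 / tau)\<^sup>2" using tau by (intro self_le_power) auto
  show ?thesis
  proof (rule jet_le_comp[where F = F and h = "softcap tau" and h' = "\<lambda>z. 1 - (tanh (z / tau))\<^sup>2"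
        and e = 1 and ?h2.0 = h2, OF fin F])
    show "(softcap tau has_real_derivative 1 - (tanh (y / tau))\<^sup>2) (at y)" for y
      unfolding softcap_def[abs_def] using tau by (auto intro!: derivative_eq_intros)
    show "((\<lambda>z. 1 - (tanh (z / tau))\<^sup>2) has_real_derivative h2) (at (F \<theta>))"
      using tau by (auto intro!: derivative_eq_intros simp: h2_def u_def)
    show "\<bar>1 - (tanh (F \<theta> / tau))\<^sup>2\<bar> \<le> 1 + 2 / tau"
      using u tau divide_pos_pos[of 2 tau] unfolding u_def[symmetric] by linarith
    show "\<bar>1 - (tanh (F \<theta> / tau))\<^sup>2\<bar> + \<bar>h2\<bar> \<le> (1 + 2 / tau)\<^sup>2"
      using u h2 K unfolding u_def[symmetric] by linarith
  qed simp
qed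

text \<open>A quadratic form is homogeneous of degree 2, so its bound on the unit ball gives a lower
  bound by a multiple of the squared norm everywhere. Norm zero is treated apart because
  \<open>v\<close> is divided by its norm.\<close>

lemma jet_le_imp_loewner:
  assumes fin: "finite I" and F: "jet_le I \<theta> F b"
  shows "\<exists>A. has_hessian_on I F A \<theta> \<and> loewner_ge_on I A (\<lambda>i j. - (b\<^sup>2) * id_matrix i j)"
proof -
  from F obtain G A where G: "hessian_at I \<theta> F G A"
    and B: "\<forall>v. L2_set v I \<le> 1 \<longrightarrow> \<bar>\<Sum>i\<in>I. G \<theta> i * v i\<bar> \<le> b \<and>
       \<bar>\<Sum>i\<in>I. \<Sum>j\<in>I. v i * A i j * v j\<bar> \<le> b\<^sup>2"
    by (rule jet_leE)
  have "has_hessian_on I F A \<theta>"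
    unfolding has_hessian_on_def using G unfolding hessian_at_def by (intro exI[of _ G]) simp
  moreover have "0 \<le> (\<Sum>i\<in>I. \<Sum>j\<in>I. v i * (A i j - - (b\<^sup>2) * id_matrix i j) * v j)" for v
  proof -
    define n where "n = L2_set v I"
    define q where "q = (\<Sum>i\<in>I. \<Sum>j\<in>I. v i * A i j * v j)"
    have n: "n\<^sup>2 = (\<Sum>i\<in>I. (v i)\<^sup>2)" "0 \<le> n"
      by (simp_all add: n_def L2_set_def sum_nonneg L2_set_nonneg)
    have "v i * (A i j - - (b\<^sup>2) * id_matrix i j) * v j
      = v i * A i j * v j + (if i = j then b\<^sup>2 * (v i)\<^sup>2 else 0)" for i j
      by (simp add: id_matrix_def algebra_simps power2_eq_square)
    hence 1: "(\<Sum>i\<in>I. \<Sum>j\<in>I. v i * (A i j - - (b\<^sup>2) * id_matrix i j) * v j) = q + b\<^sup>2 * n\<^sup>2"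
      using fin by (simp add: q_def n(1) sum.distrib sum_distrib_left cong: if_cong)
    show ?thesis
    proof (cases "n = 0")
      case True
      hence "v i = 0" if "i \<in> I" for i using that fin by (simp add: n_def L2_set_eq_0_iff)
      hence "q = 0" by (simp add: q_def)
      thus ?thesis unfolding 1 by simp
    next
      case False
      hence n0: "n > 0" using n by simp
      have "L2_set (\<lambda>i. v i / n) I = n / n"
        unfolding n_def L2_set_def by (simp add: power_divide real_sqrt_divide sum_nonneg flip: sum_divide_distrib)
      hence "L2_set (\<lambda>i. v i / n) I \<le> 1" using n0 by simp
      from B[rule_format, OF this] have "\<bar>\<Sum>i\<in>I. \<Sum>j\<in>I. v i / n * A i j * (v j / n)\<bar> \<le> b\<^sup>2" by simp
      hence "\<bar>q / n\<^sup>2\<bar> \<le> b\<^sup>2" by (simp add: q_def sum_divide_distrib power2_eq_square)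
      hence "\<bar>q\<bar> \<le> b\<^sup>2 * n\<^sup>2" using n0 by (simp add: abs_divide divide_le_eq)
      thus ?thesis unfolding 1 by linarith
    qed
  qed
  moreover have "A i j = A j i" if "i \<in> I" "j \<in> I" for i j using hessian_atD(3)[OF G that] .
  ultimately show ?thesis unfolding loewner_ge_on_def psd_on_def
    by (intro exI[of _ A]) (auto simp: id_matrix_def)
qed

section \<open>Transformer layers\<close>

lemma in_params:
  "1 \<le> v \<Longrightarrow> v \<le> V \<Longrightarrow> a < dm \<Longrightarrow> Emb v a \<in> params L dm V"
  "1 \<le> v \<Longrightarrow> v \<le> V \<Longrightarrow> a < dm \<Longrightarrow> LM v a \<in> params L dm V"
  "1 \<le> l \<Longrightarrow> l \<le> L \<Longrightarrow> a < dm \<Longrightarrow> b < dm \<Longrightarrow> WQ l a b \<in> params L dm V"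
  "1 \<le> l \<Longrightarrow> l \<le> L \<Longrightarrow> a < dm \<Longrightarrow> b < dm \<Longrightarrow> WK l a b \<in> params L dm V"
  "1 \<le> l \<Longrightarrow> l \<le> L \<Longrightarrow> a < dm \<Longrightarrow> b < dm \<Longrightarrow> WV l a b \<in> params L dm V"
  "1 \<le> l \<Longrightarrow> l \<le> L \<Longrightarrow> a < dm \<Longrightarrow> b < dm \<Longrightarrow> WO l a b \<in> params L dm V"
  "1 \<le> l \<Longrightarrow> l \<le> L \<Longrightarrow> a < 4 * dm \<Longrightarrow> b < dm \<Longrightarrow> W1 l a b \<in> params L dm V"
  "1 \<le> l \<Longrightarrow> l \<le> L \<Longrightarrow> a < dm \<Longrightarrow> b < 4 * dm \<Longrightarrow> W2 l a b \<in> params L dm V"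
proof -
  assume "1 \<le> v" "v \<le> V" "a < dm"
  hence "Emb v a \<in> (\<lambda>(v, i). Emb v i) ` ({1..V} \<times> {..<dm})"
    by (intro image_eqI[of _ _ "(v, a)"]) simp_all
  thus "Emb v a \<in> params L dm V" by (simp only: params_def Un_iff simp_thms)
next
  assume "1 \<le> v" "v \<le> V" "a < dm"
  hence "LM v a \<in> (\<lambda>(v, i). LM v i) ` ({1..V} \<times> {..<dm})"
    by (intro image_eqI[of _ _ "(v, a)"]) simp_all
  thus "LM v a \<in> params L dm V" by (simp only: params_def Un_iff simp_thms)
next
  assume "1 \<le> l" "l \<le> L" "a < dm" "b < dm"
  hence "WQ l a b \<in> (\<lambda>(l, i, j). WQ l i j) ` ({1..L} \<times> {..<dm} \<times> {..<dm})"
    by (intro image_eqI[of _ _ "(l, a, b)"]) simp_all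
  thus "WQ l a b \<in> params L dm V" by (simp only: params_def Un_iff simp_thms)
next
  assume "1 \<le> l" "l \<le> L" "a < dm" "b < dm"
  hence "WK l a b \<in> (\<lambda>(l, i, j). WK l i j) ` ({1..L} \<times> {..<dm} \<times> {..<dm})"
    by (intro image_eqI[of _ _ "(l, a, b)"]) simp_all
  thus "WK l a b \<in> params L dm V" by (simp only: params_def Un_iff simp_thms)
next
  assume "1 \<le> l" "l \<le> L" "a < dm" "b < dm"
  hence "WV l a b \<in> (\<lambda>(l, i, j). WV l i j) ` ({1..L} \<times> {..<dm} \<times> {..<dm})"
    by (intro image_eqI[of _ _ "(l, a, b)"]) simp_all
  thus "WV l a b \<in> params L dm V" by (simp only: params_def Un_iff simp_thms)
next
  assume "1 \<le> l" "l \<le> L" "a < dm" "b < dm"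
  hence "WO l a b \<in> (\<lambda>(l, i, j). WO l i j) ` ({1..L} \<times> {..<dm} \<times> {..<dm})"
    by (intro image_eqI[of _ _ "(l, a, b)"]) simp_all
  thus "WO l a b \<in> params L dm V" by (simp only: params_def Un_iff simp_thms)
next
  assume "1 \<le> l" "l \<le> L" "a < 4 * dm" "b < dm"
  hence "W1 l a b \<in> (\<lambda>(l, i, j). W1 l i j) ` ({1..L} \<times> {..<4 * dm} \<times> {..<dm})"
    by (intro image_eqI[of _ _ "(l, a, b)"]) simp_all
  thus "W1 l a b \<in> params L dm V" by (simp only: params_def Un_iff simp_thms)
next
  assume "1 \<le> l" "l \<le> L" "a < dm" "b < 4 * dm"
  hence "W2 l a b \<in> (\<lambda>(l, i, j). W2 l i j) ` ({1..L} \<times> {..<dm} \<times> {..<4 * dm})"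
    by (intro image_eqI[of _ _ "(l, a, b)"]) simp_all
  thus "W2 l a b \<in> params L dm V" by (simp only: params_def Un_iff simp_thms)
qed

lemma orthogonal_mat_entry_le:
  assumes "orthogonal_mat n R" "i < n" "j < n" shows "\<bar>R i j\<bar> \<le> 1"
proof -
  have "(R i j)\<^sup>2 \<le> (\<Sum>k<n. (R k j)\<^sup>2)" using assms by (intro member_le_sum) auto
  also have "\<dots> = 1" using assms by (auto simp: orthogonal_mat_def power2_eq_square)
  finally show ?thesis by (simp add: abs_square_le_1)
qed

text \<open>This and the following constants are what remains of the respective bounds once the
  powers of \<rho> and the incoming bound \<beta> are split off. They depend only on
  \<open>eps\<close>, \<open>cqk\<close>, \<open>dm\<close> and \<open>dh\<close>.\<close>

definition proj_const :: "nat \<Rightarrow> real" where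
  "proj_const dm = real dm * (1 + real dm)"

definition qk_const :: "real \<Rightarrow> nat \<Rightarrow> nat \<Rightarrow> real" where
  "qk_const eps dm dh = real dh * (rms_const eps dh * proj_const dm)"

definition att_logit_const :: "real \<Rightarrow> real \<Rightarrow> nat \<Rightarrow> nat \<Rightarrow> real" where
  "att_logit_const eps cqk dm dh =
    max 1 (cqk / sqrt (real dh)) * (real dh * (2 * (real dh * real dh) * qk_const eps dm dh))"

definition att_head_const :: "real \<Rightarrow> real \<Rightarrow> nat \<Rightarrow> nat \<Rightarrow> real" where
  "att_head_const eps cqk dm dh =
    proj_const dm + 6 * (real dm * real dm) * att_logit_const eps cqk dm dh"

definition att_const :: "real \<Rightarrow> real \<Rightarrow> nat \<Rightarrow> nat \<Rightarrow> real" where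
  "att_const eps cqk dm dh = real dm * (att_head_const eps cqk dm dh + real dm * real dm)"

definition mlp_const :: "nat \<Rightarrow> real" where
  "mlp_const dm = real (4 * dm) * (3 * (real dm * real dm) * proj_const dm + (real dm * real dm)\<^sup>2)"

text \<open>One factor per sublayer: the 1 stems from the skip connection, the product from the
  branch preceded by a normalisation.\<close>

definition layer_const :: "real \<Rightarrow> real \<Rightarrow> nat \<Rightarrow> nat \<Rightarrow> real" where
  "layer_const eps cqk dm dh =
    (1 + mlp_const dm * rms_const eps dm) * (1 + att_const eps cqk dm dh * rms_const eps dm)"

lemma token_seqs_nth: "x \<in> token_seqs V T \<Longrightarrow> t \<le> T \<Longrightarrow> x ! t \<in> {1..V}"
proof -
  assume x: "x \<in> token_seqs V T" "t \<le> T"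
  hence "x ! t \<in> set x" by (intro nth_mem) (simp add: token_seqs_def)
  moreover have "set x \<subseteq> {1..V}" using x by (simp add: token_seqs_def)
  ultimately show ?thesis by (rule rev_subsetD)
qed

section \<open>Derivative bounds for the forward map\<close>

text \<open>The parameter at which derivatives are taken is fixed, so that \<rho> is a number. In
  functions passed to \<open>jet\<close>, a bound variable of the same name shadows it and ranges
  over nearby parameters.\<close>

locale transformer_at =
  fixes L dm H dh V T :: nat and eps cqk :: real
    and R :: "nat \<Rightarrow> nat \<Rightarrow> nat \<Rightarrow> real" and S :: "nat \<Rightarrow> nat \<Rightarrow> nat set" and \<theta> :: "param \<Rightarrow> real"
  assumes dm: "0 < dm" and dims: "dm = H * dh" and eps: "0 < eps" and cqk: "0 < cqk"
    and R: "\<And>t. t < T \<Longrightarrow> orthogonal_mat dh (R t)"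
    and S: "\<And>l t. 1 \<le> l \<Longrightarrow> l \<le> L \<Longrightarrow> t < T \<Longrightarrow> S l t \<noteq> {} \<and> S l t \<subseteq> {0..t}"
    and \<theta>: "\<theta> \<in> params L dm V \<rightarrow>\<^sub>E UNIV"
begin

abbreviation "I \<equiv> params L dm V"
abbreviation "jet \<equiv> jet_le I \<theta>"

definition "\<rho> = 1 + L2_set \<theta> I"

lemma \<rho>: "1 \<le> \<rho>"
  by (simp add: \<rho>_def L2_set_nonneg)

lemma fin: "finite I"
  by (rule finite_params)

lemma dm1: "1 \<le> real dm"
  using dm by simp

lemma dh: "0 < dh"
  using dm dims by (intro gr0I) simp

lemma dh1: "1 \<le> real dh"
  using dh by simp

lemma abs_param_le: "p \<in> I \<Longrightarrow> \<bar>\<theta> p\<bar> \<le> \<rho>"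
proof -
  assume p: "p \<in> I"
  have "\<bar>\<theta> p\<bar> \<le> L2_set (\<lambda>i. \<bar>\<theta> i\<bar>) I" by (intro member_le_L2_set fin p)
  moreover have "L2_set (\<lambda>i. \<bar>\<theta> i\<bar>) I = L2_set \<theta> I" by (simp add: L2_set_def)
  ultimately show ?thesis by (simp add: \<rho>_def)
qed

lemma jet_param: "p \<in> I \<Longrightarrow> jet (\<lambda>\<theta>. \<theta> p) 1"
  by (rule jet_le_coord[OF fin \<theta>])

lemma head_index: "i < H \<Longrightarrow> r < dh \<Longrightarrow> i * dh + r < dm"
proof -
  assume "i < H" "r < dh"
  moreover from \<open>i < H\<close> have "Suc i * dh \<le> H * dh" by (intro mult_le_mono1) simp
  ultimately show ?thesis using dims by simp
qed

lemma proj_const_ge: "1 \<le> proj_const dm"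
  using mult_mono[of 1 "real dm" 1 "1 + real dm"] dm1 by (simp add: proj_const_def)

text \<open>Here \<open>c\<close> is any matrix constructor with its layer filled in, or
  \<open>LM\<close>. Differentiating the input costs \<rho>, the bound on the weights;
  differentiating a weight costs \<open>dm\<close>, the bound on a normalised input.\<close>

lemma jet_proj:
  assumes c: "\<And>b. b < dm \<Longrightarrow> c a b \<in> I" and \<beta>: "1 \<le> \<beta>"
    and g: "\<And>j. j < dm \<Longrightarrow> jet (\<lambda>\<theta>. g \<theta> j) \<beta>" "\<And>j. j < dm \<Longrightarrow> \<bar>g \<theta> j\<bar> \<le> dm"
  shows "jet (\<lambda>\<theta>. matvec dm (\<lambda>a b. \<theta> (c a b)) (g \<theta>) a) (proj_const dm * (\<rho> * \<beta>))"
    and "\<bar>matvec dm (\<lambda>a b. \<theta> (c a b)) (g \<theta>) a\<bar> \<le> real dm * (\<rho> * real dm)"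
proof -
  \<comment> \<open>This lets the additive \<open>dm\<close> be absorbed into a multiple of
    \<open>\<rho> * \<beta>\<close>.\<close>
  have "1 \<le> \<rho> * \<beta>" using mult_mono[of 1 \<rho> 1 \<beta>] \<rho> \<beta> by simp
  hence "real dm * 1 \<le> real dm * (\<rho> * \<beta>)" by (intro mult_left_mono) auto
  hence "real dm * (\<rho> * \<beta> + real dm) \<le> real dm * (\<rho> * \<beta> + real dm * (\<rho> * \<beta>))"
    by (intro mult_left_mono) auto
  also have "\<dots> = proj_const dm * (\<rho> * \<beta>)" by (simp add: proj_const_def algebra_simps)
  finally have le: "real dm * (\<rho> * \<beta> + real dm) \<le> proj_const dm * (\<rho> * \<beta>)" .
  show "jet (\<lambda>\<theta>. matvec dm (\<lambda>a b. \<theta> (c a b)) (g \<theta>) a) (proj_const dm * (\<rho> * \<beta>))"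
    by (rule jet_le_mono[OF jet_le_matvec[OF fin \<theta> dm1 \<rho>] le])
      (use c g \<beta> jet_param abs_param_le in auto)
  show "\<bar>matvec dm (\<lambda>a b. \<theta> (c a b)) (g \<theta>) a\<bar> \<le> real dm * (\<rho> * real dm)"
    by (rule abs_matvec_le) (use c g abs_param_le in auto)
qed

lemma matvec_head_block: "matvec n (head_block dh i W) x r = matvec n W x (i * dh + r)"
  by (simp add: matvec_def head_block_def)

text \<open>Shared by queries and keys. Normalisation within a head bounds the values independently
  of the weights, so \<rho> enters the derivatives but not the size; rotation entries are at most 1
  in absolute value.\<close>

lemma jet_qk:
  assumes c: "\<And>a b. a < dm \<Longrightarrow> b < dm \<Longrightarrow> c a b \<in> I" and \<beta>: "1 \<le> \<beta>" and i: "i < H" and r: "r < dh" and t: "t < T"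
    and g: "\<And>j. j < dm \<Longrightarrow> jet (\<lambda>\<theta>. g \<theta> j) \<beta>" "\<And>j. j < dm \<Longrightarrow> \<bar>g \<theta> j\<bar> \<le> dm"
  defines "q \<equiv> \<lambda>\<theta>. matvec dh (R t) (rmsnorm eps dh (matvec dm (head_block dh i (\<lambda>a b. \<theta> (c a b))) (g \<theta>)))"
  shows "jet (\<lambda>\<theta>. q \<theta> r) (qk_const eps dm dh * (\<rho> * \<beta>))"
    and "\<bar>q \<theta> r\<bar> \<le> real dh * real dh"
proof -
  have "jet (\<lambda>\<theta>. matvec dm (head_block dh i (\<lambda>a b. \<theta> (c a b))) (g \<theta>) j) (proj_const dm * (\<rho> * \<beta>))"
    if "j < dh" for j
    unfolding matvec_head_block by (rule jet_proj) (use c g \<beta> head_index[OF i that] in auto)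
  hence "jet (\<lambda>\<theta>. rmsnorm eps dh (matvec dm (head_block dh i (\<lambda>a b. \<theta> (c a b))) (g \<theta>)) j)
      (rms_const eps dh * (proj_const dm * (\<rho> * \<beta>)))" if "j < dh" for j
    by (intro jet_le_rmsnorm[OF fin \<theta> eps that])
  hence "jet (\<lambda>\<theta>. R t r j * rmsnorm eps dh (matvec dm (head_block dh i (\<lambda>a b. \<theta> (c a b))) (g \<theta>)) j)
      (1 * (rms_const eps dh * (proj_const dm * (\<rho> * \<beta>))))" if "j < dh" for j
    using that orthogonal_mat_entry_le[OF R[OF t] r that] by (intro jet_le_scale[OF fin]) auto
  hence "jet (\<lambda>\<theta>. \<Sum>j\<in>{..<dh}. R t r j * rmsnorm eps dh (matvec dm (head_block dh i (\<lambda>a b. \<theta> (c a b))) (g \<theta>)) j)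
      (real (card {..<dh}) * (1 * (rms_const eps dh * (proj_const dm * (\<rho> * \<beta>)))))"
    by (intro jet_le_sum[OF fin \<theta>]) auto
  thus "jet (\<lambda>\<theta>. q \<theta> r) (qk_const eps dm dh * (\<rho> * \<beta>))"
    by (simp add: q_def matvec_def qk_const_def mult.assoc)
  have "\<bar>q \<theta> r\<bar> \<le> real dh * (1 * real dh)"
    unfolding q_def
    by (rule abs_matvec_le) (use orthogonal_mat_entry_le[OF R[OF t] r] abs_rmsnorm_le[OF eps] in auto)
  thus "\<bar>q \<theta> r\<bar> \<le> real dh * real dh" by simp
qed

text \<open>Since queries and keys are bounded independently of \<theta>, the product rule merely
  adds their bounds and a single power of \<rho> suffices.\<close>

lemma jet_att_logit:
  assumes l: "1 \<le> l" "l \<le> L" and \<beta>: "1 \<le> \<beta>" and i: "i < H" and t: "t < T" and s: "s < T"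
    and g: "\<And>t j. t < T \<Longrightarrow> j < dm \<Longrightarrow> jet (\<lambda>\<theta>. g \<theta> t j) \<beta>" "\<And>t j. t < T \<Longrightarrow> j < dm \<Longrightarrow> \<bar>g \<theta> t j\<bar> \<le> dm"
  shows "jet (\<lambda>\<theta>. att_logit dm dh eps cqk R \<theta> l (g \<theta>) t i s) (att_logit_const eps cqk dm dh * (\<rho> * \<beta>))"
proof -
  let ?B = "qk_const eps dm dh * (\<rho> * \<beta>)"
  let ?d = "real dh * real dh"
  have d: "1 \<le> ?d" using mult_mono[of 1 "real dh" 1 "real dh"] dh1 by simp
  have "jet (\<lambda>\<theta>. query dm dh eps R \<theta> l (g \<theta>) t i r * key dm dh eps R \<theta> l (g \<theta>) s i r) (?d * ?B + ?d * ?B)"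
    if "r < dh" for r
    unfolding query_def key_def
    by (rule jet_le_mult[OF fin]) (use in_params l \<beta> i t s g that d in \<open>auto intro!: jet_qk\<close>)
  hence "jet (\<lambda>\<theta>. \<Sum>r\<in>{..<dh}. query dm dh eps R \<theta> l (g \<theta>) t i r * key dm dh eps R \<theta> l (g \<theta>) s i r)
      (real (card {..<dh}) * (?d * ?B + ?d * ?B))"
    by (intro jet_le_sum[OF fin \<theta>]) auto
  hence "jet (\<lambda>\<theta>. cqk / sqrt (real dh) * (\<Sum>r\<in>{..<dh}. query dm dh eps R \<theta> l (g \<theta>) t i r * key dm dh eps R \<theta> l (g \<theta>) s i r))
      (max 1 (cqk / sqrt (real dh)) * (real (card {..<dh}) * (?d * ?B + ?d * ?B)))"
    using cqk by (intro jet_le_scale[OF fin]) auto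
  thus ?thesis by (simp add: att_logit_def att_logit_const_def algebra_simps)
qed

text \<open>The second power of \<rho> comes from the softmax weights: the logit bound, of order
  \<open>\<rho> * \<beta>\<close>, is multiplied by values of size of order \<rho>.\<close>

lemma jet_att_head:
  assumes l: "1 \<le> l" "l \<le> L" and \<beta>: "1 \<le> \<beta>" and i: "i < H" and t: "t < T" and r: "r < dh"
    and g: "\<And>t j. t < T \<Longrightarrow> j < dm \<Longrightarrow> jet (\<lambda>\<theta>. g \<theta> t j) \<beta>" "\<And>t j. t < T \<Longrightarrow> j < dm \<Longrightarrow> \<bar>g \<theta> t j\<bar> \<le> dm"
  shows "jet (\<lambda>\<theta>. att_head dm dh eps cqk R S \<theta> l (g \<theta>) t i r) (att_head_const eps cqk dm dh * (\<rho> * (\<rho> * \<beta>)))"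
    and "\<bar>att_head dm dh eps cqk R S \<theta> l (g \<theta>) t i r\<bar> \<le> real dm * (\<rho> * real dm)"
proof -
  let ?\<alpha> = "real dm * (\<rho> * real dm)"
  let ?B = "att_logit_const eps cqk dm dh * (\<rho> * \<beta>)"
  have S': "finite (S l t)" "S l t \<noteq> {}" "s < T" if "s \<in> S l t" for s
    using S[OF l t] t that finite_subset[of "S l t" "{0..t}"] by auto
  have S0: "finite (S l t)" "S l t \<noteq> {}" using S[OF l t] finite_subset[of "S l t" "{0..t}"] by auto
  have v: "jet (\<lambda>\<theta>. val dm dh \<theta> l (g \<theta>) s i r) (proj_const dm * (\<rho> * \<beta>))"
    "\<bar>val dm dh \<theta> l (g \<theta>) s i r\<bar> \<le> ?\<alpha>" if "s \<in> S l t" for s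
    unfolding val_def matvec_head_block
    by (rule jet_proj; use in_params l \<beta> g S'(3)[OF that] head_index[OF i r] in auto)+
  have \<alpha>: "1 \<le> ?\<alpha>"
    using mult_mono[OF dm1 mult_mono[OF \<rho> dm1]] \<rho> by simp
  have "jet (\<lambda>\<theta>. \<Sum>s\<in>S l t. softmax (S l t) (att_logit dm dh eps cqk R \<theta> l (g \<theta>) t i) s * val dm dh \<theta> l (g \<theta>) s i r)
      (proj_const dm * (\<rho> * \<beta>) + 6 * ?\<alpha> * ?B)"
  proof (rule jet_le_softmax_average[OF fin S0])
    show "jet (\<lambda>\<theta>. att_logit dm dh eps cqk R \<theta> l (g \<theta>) t i s) ?B" if "s \<in> S l t" for s
      by (rule jet_att_logit[OF l \<beta> i t S'(3)[OF that] g])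
  qed (use v \<alpha> in auto)
  moreover have "proj_const dm * (\<rho> * \<beta>) + 6 * ?\<alpha> * ?B \<le> att_head_const eps cqk dm dh * (\<rho> * (\<rho> * \<beta>))"
  proof -
    have "1 * (\<rho> * \<beta>) \<le> \<rho> * (\<rho> * \<beta>)" using \<rho> \<beta> by (intro mult_right_mono) auto
    hence "proj_const dm * (\<rho> * \<beta>) \<le> proj_const dm * (\<rho> * (\<rho> * \<beta>))"
      using proj_const_ge by (intro mult_left_mono[of "\<rho> * \<beta>"]) auto
    thus ?thesis by (simp add: att_head_const_def algebra_simps)
  qed
  ultimately show "jet (\<lambda>\<theta>. att_head dm dh eps cqk R S \<theta> l (g \<theta>) t i r)
      (att_head_const eps cqk dm dh * (\<rho> * (\<rho> * \<beta>)))"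
    unfolding att_head_def by (rule jet_le_mono)
  show "\<bar>att_head dm dh eps cqk R S \<theta> l (g \<theta>) t i r\<bar> \<le> ?\<alpha>"
    unfolding att_head_def by (rule abs_softmax_average_le[OF S0 v(2)])
qed

text \<open>The third power of \<rho> is the size of the entries of \<open>WO\<close>.\<close>

lemma jet_att_out:
  assumes l: "1 \<le> l" "l \<le> L" and \<beta>: "1 \<le> \<beta>" and i: "i < dm" and t: "t < T"
    and g: "\<And>t j. t < T \<Longrightarrow> j < dm \<Longrightarrow> jet (\<lambda>\<theta>. g \<theta> t j) \<beta>" "\<And>t j. t < T \<Longrightarrow> j < dm \<Longrightarrow> \<bar>g \<theta> t j\<bar> \<le> dm"
  shows "jet (\<lambda>\<theta>. att_out dm dh eps cqk R S \<theta> l (g \<theta>) t i) (att_const eps cqk dm dh * (\<rho>^3 * \<beta>))"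
proof -
  let ?P = "att_head_const eps cqk dm dh"
  have \<alpha>: "1 \<le> real dm * (\<rho> * real dm)"
    using mult_mono[OF dm1 mult_mono[OF \<rho> dm1]] \<rho> by simp
  have hd: "j div dh < H" "j mod dh < dh" if "j < dm" for j
    using that dims dh by (auto simp: less_mult_imp_div_less)
  \<comment> \<open>Nonnegativity is read off from the bound for component 0 of the concatenated
    heads rather than from the formula of the constant.\<close>
  have b: "0 \<le> ?P * (\<rho> * (\<rho> * \<beta>))"
    using jet_le_nonneg[OF jet_att_head(1)[OF l \<beta> hd(1)[OF dm] t hd(2)[OF dm] g]] by simp
  have "jet (\<lambda>\<theta>. att_out dm dh eps cqk R S \<theta> l (g \<theta>) t i)
      (real dm * (\<rho> * (?P * (\<rho> * (\<rho> * \<beta>))) + real dm * (\<rho> * real dm)))"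
    unfolding att_out_def
    by (rule jet_le_matvec[OF fin \<theta> \<alpha> \<rho> b])
      (use in_params l i in \<open>auto intro!: jet_param abs_param_le jet_att_head l \<beta> hd t g\<close>)
  moreover have "real dm * (\<rho> * (?P * (\<rho> * (\<rho> * \<beta>))) + real dm * (\<rho> * real dm)) \<le> att_const eps cqk dm dh * (\<rho>^3 * \<beta>)"
  proof -
    have "\<rho> * 1 \<le> \<rho> * (\<rho> * (\<rho> * \<beta>))"
      using mult_mono[OF \<rho> mult_mono[OF \<rho> \<beta>]] \<rho> by (intro mult_left_mono) auto
    hence "real dm * (real dm * (real dm * \<rho>)) \<le> real dm * (real dm * (real dm * (\<rho> * (\<rho> * (\<rho> * \<beta>)))))"
      by (intro mult_left_mono) auto
    thus ?thesis by (simp add: att_const_def algebra_simps power3_eq_cube)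
  qed
  ultimately show ?thesis by (rule jet_le_mono)
qed

text \<open>Pre-activations have size of order \<rho> and bound of order
  \<open>\<rho> * \<beta>\<close>; squaring gives \<open>\<rho>\<^sup>2 * \<beta>\<close>, and the
  entries of \<open>W2\<close> supply the third power.\<close>

lemma jet_mlp_out:
  assumes l: "1 \<le> l" "l \<le> L" and \<beta>: "1 \<le> \<beta>" and i: "i < dm"
    and g: "\<And>j. j < dm \<Longrightarrow> jet (\<lambda>\<theta>. g \<theta> j) \<beta>" "\<And>j. j < dm \<Longrightarrow> \<bar>g \<theta> j\<bar> \<le> dm"
    and nz: "\<And>j. j < 4 * dm \<Longrightarrow> matvec dm (\<lambda>a c. \<theta> (W1 l a c)) (g \<theta>) j \<noteq> 0"
  shows "jet (\<lambda>\<theta>. mlp_out dm \<theta> l (g \<theta>) i) (mlp_const dm * (\<rho>^3 * \<beta>))"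
proof -
  let ?\<alpha> = "real dm * (\<rho> * real dm)"
  let ?M = "proj_const dm"
  have \<alpha>1: "1 \<le> ?\<alpha>"
    using mult_mono[OF dm1 mult_mono[OF \<rho> dm1]] \<rho> by simp
  note \<alpha> = \<alpha>1 one_le_power[OF \<alpha>1, of 2]
  have u: "jet (\<lambda>\<theta>. matvec dm (\<lambda>a c. \<theta> (W1 l a c)) (g \<theta>) j) (?M * (\<rho> * \<beta>))"
    "\<bar>matvec dm (\<lambda>a c. \<theta> (W1 l a c)) (g \<theta>) j\<bar> \<le> ?\<alpha>" if "j < 4 * dm" for j
    by (rule jet_proj; use in_params l \<beta> g that in auto)+
  have h: "jet (\<lambda>\<theta>. sqrelu (matvec dm (\<lambda>a c. \<theta> (W1 l a c)) (g \<theta>) j)) (3 * ?\<alpha> * (?M * (\<rho> * \<beta>)))"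
    "\<bar>sqrelu (matvec dm (\<lambda>a c. \<theta> (W1 l a c)) (g \<theta>) j)\<bar> \<le> ?\<alpha>\<^sup>2" if "j < 4 * dm" for j
    by (rule jet_le_sqrelu[OF fin u(1)[OF that]] abs_sqrelu_le; fact u(2)[OF that] \<alpha>1 nz[OF that])+
  have b: "0 \<le> 3 * ?\<alpha> * (?M * (\<rho> * \<beta>))" using jet_le_nonneg[OF h(1)[of 0]] dm by simp
  have "jet (\<lambda>\<theta>. mlp_out dm \<theta> l (g \<theta>) i) (real (4 * dm) * (\<rho> * (3 * ?\<alpha> * (?M * (\<rho> * \<beta>))) + ?\<alpha>\<^sup>2))"
    unfolding mlp_out_def
    by (rule jet_le_matvec[OF fin \<theta> \<alpha>(2) \<rho> b])
      (use in_params l i in \<open>auto intro!: jet_param abs_param_le h\<close>)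
  moreover have "real (4 * dm) * (\<rho> * (3 * ?\<alpha> * (?M * (\<rho> * \<beta>))) + ?\<alpha>\<^sup>2) \<le> mlp_const dm * (\<rho>^3 * \<beta>)"
  proof -
    \<comment> \<open>Differentiating \<open>W2\<close> leaves the size of the hidden units, of
      order \<open>\<rho>\<^sup>2\<close>, which is absorbed into
      \<open>\<rho>^3 * \<beta>\<close>.\<close>
    have "\<rho>\<^sup>2 * 1 \<le> \<rho>\<^sup>2 * (\<rho> * \<beta>)"
      using mult_mono[OF \<rho> \<beta>] \<rho> by (intro mult_left_mono) auto
    hence "\<rho>\<^sup>2 \<le> \<rho>^3 * \<beta>" by (simp add: power2_eq_square power3_eq_cube mult.assoc)
    hence e3: "(real dm * real dm)\<^sup>2 * \<rho>\<^sup>2 \<le> (real dm * real dm)\<^sup>2 * (\<rho>^3 * \<beta>)"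
      by (intro mult_left_mono) auto
    have e2: "?\<alpha>\<^sup>2 = (real dm * real dm)\<^sup>2 * \<rho>\<^sup>2" by (simp add: power2_eq_square)
    have e1: "\<rho> * (3 * ?\<alpha> * (?M * (\<rho> * \<beta>))) = 3 * (real dm * real dm) * ?M * (\<rho>^3 * \<beta>)"
      by (simp add: power3_eq_cube)
    have "\<rho> * (3 * ?\<alpha> * (?M * (\<rho> * \<beta>))) + ?\<alpha>\<^sup>2
        \<le> (3 * (real dm * real dm) * ?M + (real dm * real dm)\<^sup>2) * (\<rho>^3 * \<beta>)"
      unfolding e1 e2 distrib_right by (rule add_left_mono[OF e3])
    thus ?thesis unfolding mlp_const_def mult.assoc[of "real (4 * dm)"] by (intro mult_left_mono) auto
  qed
  ultimately show ?thesis by (rule jet_le_mono)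
qed

lemma const_nonneg: "0 \<le> att_const eps cqk dm dh" "0 \<le> mlp_const dm"
proof -
  have "0 \<le> qk_const eps dm dh" unfolding qk_const_def
    using rms_const_ge_1[of eps dh] proj_const_ge by (intro mult_nonneg_nonneg) auto
  hence "0 \<le> att_logit_const eps cqk dm dh" unfolding att_logit_const_def
    by (intro mult_nonneg_nonneg) auto
  thus "0 \<le> att_const eps cqk dm dh" "0 \<le> mlp_const dm"
    unfolding att_const_def att_head_const_def mlp_const_def
    using proj_const_ge by auto
qed

abbreviation "res \<equiv> residual dm dh eps cqk R S"
abbreviation "half \<equiv> half_layer dm dh eps cqk R S"

text \<open>The entries of \<open>f\<close> may be arbitrarily large: attention sees only the
  normalised stream, and the skip connection just adds \<open>b\<close>.\<close>

lemma jet_half_layer: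
  assumes l: "1 \<le> l" "l \<le> L" and b: "1 \<le> b" and i: "i < dm" and t: "t < T"
    and f: "\<And>t j. t < T \<Longrightarrow> j < dm \<Longrightarrow> jet (\<lambda>\<theta>. f \<theta> t j) b"
  shows "jet (\<lambda>\<theta>. half \<theta> l (f \<theta>) t i) ((1 + att_const eps cqk dm dh * rms_const eps dm) * \<rho>^3 * b)"
proof -
  let ?N = "rms_const eps dm" and ?A = "att_const eps cqk dm dh"
  have g: "jet (\<lambda>\<theta>. rmsnorm eps dm (f \<theta> t) j) (?N * b)" "\<bar>rmsnorm eps dm (f \<theta> t) j\<bar> \<le> dm"
    if "t < T" "j < dm" for t j
    by (rule jet_le_rmsnorm[OF fin \<theta> eps that(2)], erule f[OF that(1)]) (rule abs_rmsnorm_le[OF eps that(2)])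
  have Nb: "1 \<le> ?N * b" using mult_mono[OF rms_const_ge_1[of eps dm] b] rms_const_ge_1[of eps dm] by simp
  have "jet (\<lambda>\<theta>. half \<theta> l (f \<theta>) t i) (b + ?A * (\<rho>^3 * (?N * b)))"
    unfolding half_layer_def
    by (rule jet_le_add[OF fin f[OF t i] jet_att_out[OF l Nb i t]]) (use g in auto)
  moreover from \<rho> b have "1 * b \<le> \<rho>^3 * b" by (intro mult_right_mono one_le_power) auto
  hence "b + ?A * (\<rho>^3 * (?N * b)) \<le> (1 + ?A * ?N) * \<rho>^3 * b" by (simp add: algebra_simps)
  ultimately show ?thesis by (rule jet_le_mono)
qed

lemma jet_full_layer:
  assumes l: "1 \<le> l" "l \<le> L" and b: "1 \<le> b" and i: "i < dm" and t: "t < T"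
    and f: "\<And>t j. t < T \<Longrightarrow> j < dm \<Longrightarrow> jet (\<lambda>\<theta>. f \<theta> t j) b"
    and nz: "\<And>j. j < 4 * dm \<Longrightarrow>
      matvec dm (\<lambda>a c. \<theta> (W1 l a c)) (rmsnorm eps dm (half \<theta> l (f \<theta>) t)) j \<noteq> 0"
  shows "jet (\<lambda>\<theta>. full_layer dm dh eps cqk R S \<theta> l (f \<theta>) t i) (layer_const eps cqk dm dh * \<rho>^6 * b)"
proof -
  let ?N = "rms_const eps dm" and ?A = "att_const eps cqk dm dh" and ?F = "mlp_const dm"
  define b1 where "b1 = (1 + ?A * ?N) * \<rho>^3 * b"
  have N: "1 \<le> ?N" by (rule rms_const_ge_1)
  have "1 \<le> (1 + ?A * ?N)" using N const_nonneg by simp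
  hence b1: "1 \<le> b1"
    unfolding b1_def using mult_mono[of 1 "(1 + ?A * ?N) * \<rho>^3" 1 b] mult_mono[of 1 "1 + ?A * ?N" 1 "\<rho>^3"]
      one_le_power[OF \<rho>, of 3] b by simp
  have h: "jet (\<lambda>\<theta>. half \<theta> l (f \<theta>) t j) b1" if "j < dm" for j
    unfolding b1_def by (rule jet_half_layer[OF l b that t f])
  have g: "jet (\<lambda>\<theta>. rmsnorm eps dm (half \<theta> l (f \<theta>) t) j) (?N * b1)"
    "\<bar>rmsnorm eps dm (half \<theta> l (f \<theta>) t) j\<bar> \<le> dm" if "j < dm" for j
    by (rule jet_le_rmsnorm[OF fin \<theta> eps that], erule h) (rule abs_rmsnorm_le[OF eps that])
  have Nb: "1 \<le> ?N * b1" using mult_mono[OF N b1] N by simp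
  have "jet (\<lambda>\<theta>. full_layer dm dh eps cqk R S \<theta> l (f \<theta>) t i) (b1 + ?F * (\<rho>^3 * (?N * b1)))"
    unfolding full_layer_def
    by (rule jet_le_add[OF fin h[OF i] jet_mlp_out[OF l Nb i]]) (use g nz in auto)
  moreover have "b1 + ?F * (\<rho>^3 * (?N * b1)) \<le> layer_const eps cqk dm dh * \<rho>^6 * b"
  proof -
    have "1 * b1 \<le> \<rho>^3 * b1" using \<rho> b1 by (intro mult_right_mono one_le_power) auto
    hence "b1 + ?F * (\<rho>^3 * (?N * b1)) \<le> (1 + ?F * ?N) * (\<rho>^3 * b1)" by (simp add: algebra_simps)
    also have "\<dots> = layer_const eps cqk dm dh * (\<rho>^3 * \<rho>^3) * b"
      unfolding layer_const_def b1_def by (simp add: mult.assoc mult.left_commute)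
    also have "\<rho>^3 * \<rho>^3 = \<rho>^6" by (simp flip: power_add)
    finally show ?thesis .
  qed
  ultimately show ?thesis by (rule jet_le_mono)
qed

lemma layer_const_ge_1: "1 \<le> layer_const eps cqk dm dh"
proof -
  have "0 \<le> rms_const eps dm" using rms_const_ge_1[of eps dm] by simp
  thus ?thesis unfolding layer_const_def
    using mult_mono[of 1 "1 + mlp_const dm * rms_const eps dm" 1 "1 + att_const eps cqk dm dh * rms_const eps dm"]
      const_nonneg by simp
qed

lemma jet_residual:
  assumes x: "x \<in> token_seqs V T" and l: "l \<le> L"
    and nz: "\<And>l t j. l < L \<Longrightarrow> t < T \<Longrightarrow> j < 4 * dm \<Longrightarrow>
      matvec dm (\<lambda>a c. \<theta> (W1 (Suc l) a c)) (rmsnorm eps dm (half \<theta> (Suc l) (res \<theta> x l) t)) j \<noteq> 0"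
    and "t < T" "i < dm"
  shows "jet (\<lambda>\<theta>. res \<theta> x l t i) ((layer_const eps cqk dm dh * \<rho>^6) ^ l)"
  using l assms(4-)
proof (induction l arbitrary: t i)
  \<comment> \<open>An embedding entry is a coordinate function with bound 1, the zeroth power. The
    token lies in the vocabulary, so this coordinate belongs to \<open>I\<close>.\<close>
  case 0
  have "x ! t \<in> {1..V}" using token_seqs_nth[OF x] 0 by simp
  thus ?case using 0 by (auto intro!: jet_param in_params)
next
  case (Suc l)
  have "1 * 1 \<le> layer_const eps cqk dm dh * \<rho>^6"
    using layer_const_ge_1 \<rho> by (intro mult_mono one_le_power) auto
  hence b: "1 \<le> (layer_const eps cqk dm dh * \<rho>^6) ^ l" by (intro one_le_power) simp
  have "jet (\<lambda>\<theta>. full_layer dm dh eps cqk R S \<theta> (Suc l) (res \<theta> x l) t i)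
      (layer_const eps cqk dm dh * \<rho>^6 * (layer_const eps cqk dm dh * \<rho>^6) ^ l)"
    by (rule jet_full_layer[OF _ _ b]) (use Suc nz in auto)
  thus ?case by simp
qed

text \<open>The head adds a normalisation, a projection with one more power of \<rho>, and the
  softcap. The 5 is 4 for log-sum-exp plus 1 for the target logit.\<close>

lemma jet_seq_loss:
  assumes x: "x \<in> token_seqs V T" and tau: "0 < tau" and V: "0 < V" and T: "0 < T"
    and nz: "\<And>l t j. l < L \<Longrightarrow> t < T \<Longrightarrow> j < 4 * dm \<Longrightarrow>
      matvec dm (\<lambda>a c. \<theta> (W1 (Suc l) a c)) (rmsnorm eps dm (half \<theta> (Suc l) (res \<theta> x l) t)) j \<noteq> 0"
  shows "jet (\<lambda>\<theta>. seq_loss L dm dh eps tau cqk V T R S \<theta> x)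
    (5 * ((1 + 2 / tau) * (proj_const dm * (\<rho> * (rms_const eps dm * (layer_const eps cqk dm dh * \<rho>^6) ^ L)))))"
proof -
  let ?b = "(layer_const eps cqk dm dh * \<rho>^6) ^ L"
  let ?c = "(1 + 2 / tau) * (proj_const dm * (\<rho> * (rms_const eps dm * ?b)))"
  let ?z = "\<lambda>\<theta>. logit L dm dh eps tau cqk R S \<theta> x"
  have "1 * 1 \<le> layer_const eps cqk dm dh * \<rho>^6"
    using layer_const_ge_1 \<rho> by (intro mult_mono one_le_power) auto
  hence b: "1 \<le> ?b" by (intro one_le_power) simp
  have Nb: "1 \<le> rms_const eps dm * ?b"
    using mult_mono[OF rms_const_ge_1[of eps dm] b] rms_const_ge_1[of eps dm] by simp
  have z: "jet (\<lambda>\<theta>. ?z \<theta> t j) ?c" if t: "t < T" and j: "j \<in> {1..V}" for t j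
    unfolding logit_def
  proof (rule jet_le_softcap[OF fin _ tau], rule jet_proj(1)[OF _ Nb])
    show "jet (\<lambda>\<theta>. rmsnorm eps dm (res \<theta> x L t) k) (rms_const eps dm * ?b)" if "k < dm" for k
      by (rule jet_le_rmsnorm[OF fin \<theta> eps that]) (rule jet_residual[OF x order_refl nz t])
  qed (use j in_params abs_rmsnorm_le[OF eps] in auto)
  have "jet (\<lambda>\<theta>. ln (\<Sum>j\<in>{1..V}. exp (?z \<theta> t j)) - ?z \<theta> t (x ! (t + 1))) (4 * ?c + ?c)" if t: "t < T" for t
  proof (rule jet_le_diff[OF fin])
    show "jet (\<lambda>\<theta>. ln (\<Sum>j\<in>{1..V}. exp (?z \<theta> t j))) (4 * ?c)"
      by (rule jet_le_log_sum_exp[OF fin]) (use z t V in auto)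
    have "x ! (t + 1) \<in> {1..V}" using token_seqs_nth[OF x] t by simp
    thus "jet (\<lambda>\<theta>. ?z \<theta> t (x ! (t + 1))) ?c" by (rule z[OF t])
  qed
  \<comment> \<open>Uniform weights over the positions form a convex combination, so
    \<open>T\<close> drops out of the bound.\<close>
  hence "jet (\<lambda>\<theta>. \<Sum>t\<in>{..<T}. 1 / real T * (ln (\<Sum>j\<in>{1..V}. exp (?z \<theta> t j)) - ?z \<theta> t (x ! (t + 1)))) (4 * ?c + ?c)"
    using T by (intro jet_le_convex[OF fin]) auto
  moreover have "4 * ?c + ?c = 5 * ?c" by simp
  ultimately show ?thesis unfolding seq_loss_def sum_distrib_left by (simp only:)
qed

end

section \<open>Almost everywhere nonzero pre-activations\<close>

text \<open>Fubini in coordinate \<open>p\<close>: on each line parallel to that axis slope and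
  intercept are constant, so a nonzero slope leaves at most one root.\<close>

lemma AE_affine_nonzero_single:
  fixes a b :: "('i \<Rightarrow> real) \<Rightarrow> real"
  assumes fin: "finite I" and p: "p \<in> I"
    and meas: "a \<in> borel_measurable (\<Pi>\<^sub>M i\<in>I. lborel)" "b \<in> borel_measurable (\<Pi>\<^sub>M i\<in>I. lborel)"
    and inv: "\<And>\<theta> y. a (\<theta>(p := y)) = a \<theta>" "\<And>\<theta> y. b (\<theta>(p := y)) = b \<theta>"
  shows "AE \<theta> in (\<Pi>\<^sub>M i\<in>I. lborel). a \<theta> \<noteq> 0 \<longrightarrow> b \<theta> + \<theta> p * a \<theta> \<noteq> 0"
proof -
  let ?M = "\<Pi>\<^sub>M i\<in>I. (lborel :: real measure)"
  define N where "N = {\<theta> \<in> space ?M. a \<theta> \<noteq> 0 \<and> b \<theta> + \<theta> p * a \<theta> = 0}"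
  interpret product_sigma_finite "\<lambda>_::'i. lborel :: real measure" by standard
  have pm: "(\<lambda>\<theta>. \<theta> p) \<in> borel_measurable ?M"
    using measurable_component_singleton[OF p, of "\<lambda>_. lborel"] by simp
  have N: "N \<in> sets ?M" unfolding N_def using meas pm by measurable
  have I: "insert p (I - {p}) = I" using p by auto
  have "emeasure ?M N = (\<integral>\<^sup>+ \<theta>. indicator N \<theta> \<partial>?M)" using N by simp
  also have "\<dots> = (\<integral>\<^sup>+ x. \<integral>\<^sup>+ y. indicator N (x(p := y)) \<partial>lborel \<partial>(\<Pi>\<^sub>M i\<in>I - {p}. lborel))"
    using product_nn_integral_insert[of "I - {p}" p "indicator N"] fin N unfolding I by simp
  also have "\<dots> = (\<integral>\<^sup>+ x. 0 \<partial>(\<Pi>\<^sub>M i\<in>I - {p}. (lborel :: real measure)))"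
  proof (rule nn_integral_cong)
    fix x
    \<comment> \<open>If \<open>a x = 0\<close>, the quotient is 0 by convention; excluding that
      value is harmless, as the whole line then misses \<open>N\<close>.\<close>
    have "AE y in lborel. y \<noteq> - b x / a x" by (rule AE_lborel_singleton)
    hence "AE y in lborel. indicator N (x(p := y)) = (0 :: ennreal)"
    proof eventually_elim
      case (elim y)
      have "x(p := y) \<notin> N"
      proof
        assume "x(p := y) \<in> N"
        hence "a x \<noteq> 0" "b x + y * a x = 0" unfolding N_def using inv by auto
        hence "y = - b x / a x" by (simp add: field_simps)
        thus False using elim by simp
      qed
      thus ?case by simp
    qed
    thus "(\<integral>\<^sup>+ y. indicator N (x(p := y)) \<partial>lborel) = 0"
      using nn_integral_cong_AE[of _ "\<lambda>_. 0" lborel] by fastforce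
  qed
  finally have "emeasure ?M N = 0" by simp
  hence "N \<in> null_sets ?M" using N by (simp add: null_sets_def)
  thus ?thesis by (rule AE_I') (auto simp: N_def)
qed

text \<open>Outside \<open>I\<close> a coordinate is constantly \<open>undefined\<close> on the
  space. Measurability of the activations can thus be shown without tracking index ranges.\<close>

lemma borel_measurable_param:
  "(\<lambda>\<theta>. \<theta> p) \<in> borel_measurable (\<Pi>\<^sub>M i\<in>I. (lborel :: real measure))"
proof (cases "p \<in> I")
  case True
  thus ?thesis using measurable_component_singleton[OF True, of "\<lambda>_. lborel"] by simp
next
  case False
  hence "\<theta> p = undefined" if "\<theta> \<in> space (\<Pi>\<^sub>M i\<in>I. (lborel :: real measure))" for \<theta>
    using that by (auto simp: space_PiM PiE_def extensional_def)
  hence "(\<lambda>\<theta>. \<theta> p) \<in> borel_measurable (\<Pi>\<^sub>M i\<in>I. (lborel :: real measure)) \<longleftrightarrow>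
      (\<lambda>\<theta>. undefined :: real) \<in> borel_measurable (\<Pi>\<^sub>M i\<in>I. (lborel :: real measure))"
    by (rule measurable_cong[where f = "\<lambda>\<theta>. \<theta> p" and g = "\<lambda>_. undefined"])
  thus ?thesis by simp
qed

text \<open>Any index \<open>k\<close> with \<open>h k \<theta> \<noteq> 0\<close> can provide the
  slope, while the other summands join the intercept; injectivity of \<open>P\<close> keeps them
  fixed as coordinate \<open>P k\<close> varies. This leaves finitely many null sets.\<close>

lemma AE_affine_nonzero:
  fixes h :: "nat \<Rightarrow> ('i \<Rightarrow> real) \<Rightarrow> real"
  assumes fin: "finite I" and P: "inj_on P {..<n}" "\<And>j. j < n \<Longrightarrow> P j \<in> I"
    and meas: "\<And>j. j < n \<Longrightarrow> h j \<in> borel_measurable (\<Pi>\<^sub>M i\<in>I. lborel)" "c \<in> borel_measurable (\<Pi>\<^sub>M i\<in>I. lborel)"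
    and inv: "\<And>\<theta> y j k. j < n \<Longrightarrow> k < n \<Longrightarrow> h j (\<theta>(P k := y)) = h j \<theta>"
      "\<And>\<theta> y k. k < n \<Longrightarrow> c (\<theta>(P k := y)) = c \<theta>"
  shows "AE \<theta> in (\<Pi>\<^sub>M i\<in>I. lborel). (\<exists>j<n. h j \<theta> \<noteq> 0) \<longrightarrow> c \<theta> + (\<Sum>j<n. \<theta> (P j) * h j \<theta>) \<noteq> 0"
proof -
  have "AE \<theta> in (\<Pi>\<^sub>M i\<in>I. lborel). \<forall>k\<in>{..<n}. h k \<theta> \<noteq> 0 \<longrightarrow> c \<theta> + (\<Sum>j<n. \<theta> (P j) * h j \<theta>) \<noteq> 0"
  proof (rule AE_finite_allI)
    fix k assume "k \<in> {..<n}"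
    hence k: "k < n" by simp
    let ?b = "\<lambda>\<theta>. c \<theta> + (\<Sum>j\<in>{..<n}-{k}. \<theta> (P j) * h j \<theta>)"
    have "AE \<theta> in (\<Pi>\<^sub>M i\<in>I. lborel). h k \<theta> \<noteq> 0 \<longrightarrow> ?b \<theta> + \<theta> (P k) * h k \<theta> \<noteq> 0"
    proof (rule AE_affine_nonzero_single[OF fin P(2)[OF k] meas(1)[OF k]])
      show "?b \<in> borel_measurable (\<Pi>\<^sub>M i\<in>I. lborel)"
        using meas by (intro borel_measurable_add borel_measurable_sum borel_measurable_times borel_measurable_param) auto
      show "?b (\<theta>(P k := y)) = ?b \<theta>" for \<theta> y
      proof -
        have "P j \<noteq> P k" if "j \<in> {..<n} - {k}" for j using that k P(1) by (auto simp: inj_on_def)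
        hence "(\<Sum>j\<in>{..<n}-{k}. (\<theta>(P k := y)) (P j) * h j (\<theta>(P k := y))) = (\<Sum>j\<in>{..<n}-{k}. \<theta> (P j) * h j \<theta>)"
          using inv(1)[OF _ k] by (intro sum.cong) auto
        thus ?thesis using inv(2)[OF k] by simp
      qed
    qed (use inv(1)[OF k k] in simp)
    moreover have "?b \<theta> + \<theta> (P k) * h k \<theta> = c \<theta> + (\<Sum>j<n. \<theta> (P j) * h j \<theta>)" for \<theta>
      using sum.remove[of "{..<n}" k "\<lambda>j. \<theta> (P j) * h j \<theta>"] k by simp
    ultimately show "AE \<theta> in (\<Pi>\<^sub>M i\<in>I. lborel). h k \<theta> \<noteq> 0 \<longrightarrow> c \<theta> + (\<Sum>j<n. \<theta> (P j) * h j \<theta>) \<noteq> 0"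
      by simp
  qed simp
  thus ?thesis by eventually_elim auto
qed

text \<open>Row 0 of the matrix suffices. If some \<open>h \<theta> j\<close> is nonzero, component
  0 of the sum is almost surely nonzero; if all of them vanish, the update is zero and
  \<open>f\<close> survives unchanged.\<close>

lemma AE_residual_update_nonzero:
  fixes f h :: "('i \<Rightarrow> real) \<Rightarrow> nat \<Rightarrow> real"
  assumes fin: "finite I" and d: "0 < d"
    and c: "inj (c 0)" "\<And>j. j < n \<Longrightarrow> c 0 j \<in> I"
    and meas: "\<And>j. j < n \<Longrightarrow> (\<lambda>\<theta>. h \<theta> j) \<in> borel_measurable (\<Pi>\<^sub>M i\<in>I. lborel)"
      "(\<lambda>\<theta>. f \<theta> 0) \<in> borel_measurable (\<Pi>\<^sub>M i\<in>I. lborel)"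
    and inv: "\<And>\<theta> y j k. j < n \<Longrightarrow> k < n \<Longrightarrow> h (\<theta>(c 0 k := y)) j = h \<theta> j"
      "\<And>\<theta> y k. k < n \<Longrightarrow> f (\<theta>(c 0 k := y)) 0 = f \<theta> 0"
    and f: "AE \<theta> in (\<Pi>\<^sub>M i\<in>I. lborel). \<exists>i<d. f \<theta> i \<noteq> 0"
  shows "AE \<theta> in (\<Pi>\<^sub>M i\<in>I. lborel). \<exists>i<d. f \<theta> i + matvec n (\<lambda>a b. \<theta> (c a b)) (h \<theta>) i \<noteq> 0"
proof -
  have "AE \<theta> in (\<Pi>\<^sub>M i\<in>I. lborel). (\<exists>j<n. h \<theta> j \<noteq> 0) \<longrightarrow> f \<theta> 0 + (\<Sum>j<n. \<theta> (c 0 j) * h \<theta> j) \<noteq> 0"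
    by (rule AE_affine_nonzero[where h = "\<lambda>j \<theta>. h \<theta> j" and P = "c 0" and c = "\<lambda>\<theta>. f \<theta> 0", OF fin])
      (use c meas inv in \<open>auto intro: inj_on_subset\<close>)
  with f show ?thesis
  proof eventually_elim
    case (elim \<theta>)
    show ?case
    proof (cases "\<exists>j<n. h \<theta> j \<noteq> 0")
      case True
      thus ?thesis using elim d by (auto simp: matvec_def)
    next
      case False
      hence "matvec n (\<lambda>a b. \<theta> (c a b)) (h \<theta>) i = 0" for i by (simp add: matvec_def)
      thus ?thesis using elim by simp
    qed
  qed
qed

section \<open>Which parameters an activation depends on\<close>

text \<open>The index is chosen so that the residual stream after \<open>l\<close> layers depends
  only on parameters of index at most \<open>l\<close>. Embeddings get 0, as layers are counted from
  1.\<close>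

primrec param_layer :: "param \<Rightarrow> nat" where
  "param_layer (Emb v i) = 0"
| "param_layer (WQ l i j) = l"
| "param_layer (WK l i j) = l"
| "param_layer (WV l i j) = l"
| "param_layer (WO l i j) = l"
| "param_layer (W1 l i j) = l"
| "param_layer (W2 l i j) = l"
| "param_layer (LM v i) = 0"

lemma residual_upd:
  "l < param_layer p \<Longrightarrow> residual dm dh eps cqk R S (\<theta>(p := y)) x l = residual dm dh eps cqk R S \<theta> x l"
proof (induction l)
  case 0
  hence "Emb v i \<noteq> p" for v i by auto
  thus ?case by simp
next
  case (Suc l)
  hence "WQ (Suc l) a b \<noteq> p" "WK (Suc l) a b \<noteq> p" "WV (Suc l) a b \<noteq> p" "WO (Suc l) a b \<noteq> p"
    "W1 (Suc l) a b \<noteq> p" "W2 (Suc l) a b \<noteq> p" for a b by auto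
  thus ?case using Suc
    by (simp add: full_layer_def half_layer_def att_out_def mlp_out_def att_head_def[abs_def] att_logit_def[abs_def]
        query_def key_def val_def)
qed

text \<open>Within a layer \<open>WO\<close> acts only after the heads are formed, so it can vary
  while the vector it multiplies stays fixed.\<close>

lemma att_head_upd_WO: "att_head dm dh eps cqk R S (\<theta>(WO m a b := y)) l g t i r = att_head dm dh eps cqk R S \<theta> l g t i r"
  by (simp add: att_head_def att_logit_def[abs_def] query_def key_def val_def)

text \<open>Lets the MLP weights of a layer vary while the input of the MLP stays fixed.\<close>

lemma half_layer_upd:
  assumes "\<And>a b. p \<noteq> WQ l a b" "\<And>a b. p \<noteq> WK l a b" "\<And>a b. p \<noteq> WV l a b" "\<And>a b. p \<noteq> WO l a b"
  shows "half_layer dm dh eps cqk R S (\<theta>(p := y)) l f = half_layer dm dh eps cqk R S \<theta> l f"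
  using assms[symmetric]
  by (simp add: half_layer_def att_out_def att_head_def[abs_def] att_logit_def[abs_def] query_def key_def val_def)

section \<open>Measurability of the forward map\<close>

context
  fixes M :: "(param \<Rightarrow> real) measure"
  assumes param[measurable]: "\<And>p. (\<lambda>\<theta>. \<theta> p) \<in> borel_measurable M"
begin

lemma borel_measurable_matvec:
  assumes "\<And>j. (\<lambda>\<theta>. W \<theta> i j) \<in> borel_measurable M" "\<And>j. (\<lambda>\<theta>. x \<theta> j) \<in> borel_measurable M"
  shows "(\<lambda>\<theta>. matvec n (W \<theta>) (x \<theta>) i) \<in> borel_measurable M"
  using assms unfolding matvec_def by measurable

lemma borel_measurable_rmsnorm:
  assumes "\<And>j. (\<lambda>\<theta>. x \<theta> j) \<in> borel_measurable M"
  shows "(\<lambda>\<theta>. rmsnorm eps k (x \<theta>) i) \<in> borel_measurable M"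
  using assms unfolding rmsnorm_def by measurable

lemma borel_measurable_att_head:
  assumes g: "\<And>t j. (\<lambda>\<theta>. g \<theta> t j) \<in> borel_measurable M"
  shows "(\<lambda>\<theta>. att_head dm dh eps cqk R S \<theta> l (g \<theta>) t i r) \<in> borel_measurable M"
proof -
  have q: "(\<lambda>\<theta>. query dm dh eps R \<theta> l (g \<theta>) t i r) \<in> borel_measurable M" for t r
    unfolding query_def
    by (intro borel_measurable_matvec borel_measurable_rmsnorm borel_measurable_const g)
      (simp add: head_block_def param)
  have k: "(\<lambda>\<theta>. key dm dh eps R \<theta> l (g \<theta>) t i r) \<in> borel_measurable M" for t r
    unfolding key_def
    by (intro borel_measurable_matvec borel_measurable_rmsnorm borel_measurable_const g)
      (simp add: head_block_def param)
  have v: "(\<lambda>\<theta>. val dm dh \<theta> l (g \<theta>) t i r) \<in> borel_measurable M" for t r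
    unfolding val_def by (intro borel_measurable_matvec g) (simp add: head_block_def param)
  have a: "(\<lambda>\<theta>. att_logit dm dh eps cqk R \<theta> l (g \<theta>) t i s) \<in> borel_measurable M" for s
    unfolding att_logit_def using q k by measurable
  show ?thesis unfolding att_head_def softmax_def using a v by measurable
qed

lemma borel_measurable_half_layer:
  assumes f: "\<And>t j. (\<lambda>\<theta>. f \<theta> t j) \<in> borel_measurable M"
  shows "(\<lambda>\<theta>. half_layer dm dh eps cqk R S \<theta> l (f \<theta>) t i) \<in> borel_measurable M"
  unfolding half_layer_def att_out_def
  by (intro borel_measurable_add f borel_measurable_matvec param borel_measurable_att_head borel_measurable_rmsnorm)

lemma borel_measurable_sqrelu:
  "f \<in> borel_measurable M \<Longrightarrow> (\<lambda>\<theta>. sqrelu (f \<theta>)) \<in> borel_measurable M"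
  unfolding sqrelu_def by (intro borel_measurable_power borel_measurable_max borel_measurable_const)

lemma borel_measurable_residual:
  "(\<lambda>\<theta>. residual dm dh eps cqk R S \<theta> x l t i) \<in> borel_measurable M"
proof (induction l arbitrary: t i)
  case (Suc l)
  show ?case
    unfolding residual.simps full_layer_def mlp_out_def
    by (intro borel_measurable_add borel_measurable_half_layer Suc borel_measurable_matvec param
        borel_measurable_sqrelu borel_measurable_rmsnorm)
qed (simp add: param)

end

lemma AE_pre_activation_nonzero:
  assumes dm: "0 < dm" and eps: "0 < eps" and x: "x \<in> token_seqs V T" and l: "l < L" and t: "t < T" and j: "j < 4 * dm"
  shows "AE \<theta> in param_space L dm V. matvec dm (\<lambda>a c. \<theta> (W1 (Suc l) a c))
    (rmsnorm eps dm (half_layer dm dh eps cqk R S \<theta> (Suc l) (residual dm dh eps cqk R S \<theta> x l) t)) j \<noteq> 0"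
proof -
  note param = borel_measurable_param[of _ "params L dm V"]
  note fin = finite_params[of L dm V]
  let ?res = "residual dm dh eps cqk R S" and ?half = "half_layer dm dh eps cqk R S"
  \<comment> \<open>The matrix that varies is \<open>WO (Suc l)\<close>: neither the incoming stream
    nor the heads of this layer depend on it.\<close>
  have half: "AE \<theta> in param_space L dm V. \<exists>i<dm. ?half \<theta> (Suc l) (?res \<theta> x l) t i \<noteq> 0"
    if "l < L" "AE \<theta> in param_space L dm V. \<exists>i<dm. ?res \<theta> x l t i \<noteq> 0" for l
    unfolding half_layer_def att_out_def
    by (rule AE_residual_update_nonzero[where c = "WO (Suc l)", OF fin dm _ _ _ _ _ _ that(2)])
      (use that(1) dm in \<open>auto simp: residual_upd att_head_upd_WO inj_def
        intro!: in_params borel_measurable_att_head param borel_measurable_residual borel_measurable_rmsnorm\<close>)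
  have res: "AE \<theta> in param_space L dm V. \<exists>i<dm. ?res \<theta> x l t i \<noteq> 0" if "l < L" for l
    using that
  proof (induction l)
    case 0
    have p: "Emb (x ! t) 0 \<in> params L dm V"
      using token_seqs_nth[OF x, of t] t dm by (intro in_params) auto
    \<comment> \<open>A single embedding entry is affine in itself, with slope 1 and intercept
      0.\<close>
    have "AE \<theta> in param_space L dm V. (1::real) \<noteq> 0 \<longrightarrow> 0 + \<theta> (Emb (x ! t) 0) * 1 \<noteq> 0"
      by (rule AE_affine_nonzero_single[OF fin p]) auto
    thus ?case using dm by (auto elim!: eventually_mono)
  next
    case (Suc l)
    \<comment> \<open>For the MLP update \<open>W2 (Suc l)\<close> varies, and the stream after
      attention is independent of it.\<close>
    have h: "?half (\<theta>(W2 m a b := y)) k f = ?half \<theta> k f" for \<theta> m a b y k f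
      by (rule half_layer_upd) auto
    show ?case
      unfolding residual.simps full_layer_def mlp_out_def
      by (rule AE_residual_update_nonzero[where c = "W2 (Suc l)", OF fin dm _ _ _ _ _ _ half])
        (use Suc dm in \<open>auto simp: residual_upd h inj_def
          intro!: in_params borel_measurable_half_layer borel_measurable_sqrelu borel_measurable_matvec
            param borel_measurable_residual borel_measurable_rmsnorm\<close>)
  qed
  have h: "?half (\<theta>(W1 m a b := y)) k f = ?half \<theta> k f" for \<theta> m a b y k f
    by (rule half_layer_upd) auto
  let ?g = "\<lambda>\<theta>. rmsnorm eps dm (?half \<theta> (Suc l) (?res \<theta> x l) t)"
  \<comment> \<open>Now row \<open>j\<close> of \<open>W1\<close> varies; the intercept is 0 and the
    slopes are the components of the normalised stream.\<close>
  have "AE \<theta> in param_space L dm V. (\<exists>i<dm. ?g \<theta> i \<noteq> 0) \<longrightarrow> 0 + (\<Sum>c<dm. \<theta> (W1 (Suc l) j c) * ?g \<theta> c) \<noteq> 0"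
    by (rule AE_affine_nonzero[where h = "\<lambda>i \<theta>. ?g \<theta> i" and P = "W1 (Suc l) j" and c = "\<lambda>_. 0", OF fin])
      (use l j in \<open>auto simp: residual_upd h inj_on_def
        intro!: in_params borel_measurable_half_layer param borel_measurable_residual borel_measurable_rmsnorm\<close>)
  with half[OF l res[OF l]] show ?thesis
  proof eventually_elim
    case (elim \<theta>)
    \<comment> \<open>Normalisation divides by a positive number, so it carries nonvanishing of the
      stream over to the slopes.\<close>
    have "rmsnorm eps dm y i \<noteq> 0 \<longleftrightarrow> y i \<noteq> 0" for y i
    proof -
      have "0 < 1 / real dm * (\<Sum>j<dm. (y j)\<^sup>2) + eps"
        using eps by (intro add_nonneg_pos mult_nonneg_nonneg sum_nonneg) auto
      thus ?thesis by (simp add: rmsnorm_def)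
    qed
    thus ?case using elim by (auto simp: matvec_def)
  qed
qed

section \<open>The potential\<close>

text \<open>The potential has jet bound \<open>\<rho> ^ (6 * L + 1)\<close> times this number, whose
  square becomes the constant of the theorem. Neither \<open>V\<close> nor \<open>T\<close>
  occurs.\<close>

definition hessian_const :: "real \<Rightarrow> real \<Rightarrow> real \<Rightarrow> nat \<Rightarrow> nat \<Rightarrow> nat \<Rightarrow> real" where
  "hessian_const eps tau cqk L dm dh =
    5 * ((1 + 2 / tau) * (proj_const dm * (rms_const eps dm * layer_const eps cqk dm dh ^ L)))"

lemma finite_token_seqs: "finite (token_seqs V T)"
  unfolding token_seqs_def using finite_lists_length_eq[of "{1..V}" "T + 1"]
  by (rule finite_subset[rotated]) auto

text \<open>There are only finitely many token sequences, so the expectation is a convex combination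
  with weights \<open>pmf D x\<close>, and the bound is the same for every distribution.\<close>

lemma jet_le_potential:
  assumes D: "set_pmf D \<subseteq> token_seqs V T"
    and F: "\<And>x. x \<in> token_seqs V T \<Longrightarrow> jet_le (params L dm V) \<theta> (\<lambda>\<theta>. seq_loss L dm dh eps tau cqk V T R S \<theta> x) b"
  shows "jet_le (params L dm V) \<theta> (potential L dm dh eps tau cqk V T R S D) b"
proof -
  let ?X = "token_seqs V T"
  have "jet_le (params L dm V) \<theta> (\<lambda>\<theta>. \<Sum>x\<in>?X. pmf D x * seq_loss L dm dh eps tau cqk V T R S \<theta> x) b"
    by (rule jet_le_convex[OF finite_params finite_token_seqs pmf_nonneg sum_pmf_eq_1[OF finite_token_seqs D] F])
  moreover have "potential L dm dh eps tau cqk V T R S D = (\<lambda>\<theta>. \<Sum>x\<in>?X. pmf D x * seq_loss L dm dh eps tau cqk V T R S \<theta> x)"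
    unfolding potential_def
    using D by (intro ext) (subst integral_measure_pmf_real[OF finite_token_seqs[of V T]], auto simp: mult.commute)
  ultimately show ?thesis by simp
qed

theorem theorem3:
  fixes L dm H dh :: nat and eps tau cqk :: real
  assumes "1 \<le> L" and "0 < dm" and "0 < H" and "dm = H * dh"
    and "0 < eps" and "0 < tau" and "0 < cqk"
  shows "\<exists>c::real. \<forall>(V::nat) (T::nat) (R :: nat \<Rightarrow> nat \<Rightarrow> nat \<Rightarrow> real) (S :: nat \<Rightarrow> nat \<Rightarrow> nat set)
      (D :: nat list pmf).
    0 < V \<longrightarrow> 0 < T \<longrightarrow>
    (\<forall>t<T. orthogonal_mat dh (R t)) \<longrightarrow>
    (\<forall>l\<in>{1..L}. \<forall>t<T. S l t \<noteq> {} \<and> S l t \<subseteq> {0..t}) \<longrightarrow>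
    set_pmf D \<subseteq> token_seqs V T \<longrightarrow>
    (AE \<theta> in param_space L dm V. \<exists>A.
       has_hessian_on (params L dm V) (potential L dm dh eps tau cqk V T R S D) A \<theta> \<and>
       loewner_ge_on (params L dm V) A
         (\<lambda>i j. - c * (1 + L2_set \<theta> (params L dm V)) ^ (12 * L + 2) * id_matrix i j))"
proof (intro exI allI impI)
  fix V T :: nat and R :: "nat \<Rightarrow> nat \<Rightarrow> nat \<Rightarrow> real" and S :: "nat \<Rightarrow> nat \<Rightarrow> nat set"
    and D :: "nat list pmf"
  assume V: "0 < V" and T: "0 < T" and R: "\<forall>t<T. orthogonal_mat dh (R t)"
    and S: "\<forall>l\<in>{1..L}. \<forall>t<T. S l t \<noteq> {} \<and> S l t \<subseteq> {0..t}"
    and D: "set_pmf D \<subseteq> token_seqs V T"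
  let ?I = "params L dm V" and ?C = "hessian_const eps tau cqk L dm dh"
  \<comment> \<open>Only finitely many pre-activations occur, so the union of their exceptional sets
    is null. The index \<open>l < L\<close> stands for layer \<open>Suc l\<close>.\<close>
  have "AE \<theta> in param_space L dm V. \<forall>x\<in>token_seqs V T. \<forall>l\<in>{..<L}. \<forall>t\<in>{..<T}. \<forall>j\<in>{..<4 * dm}.
      matvec dm (\<lambda>a c. \<theta> (W1 (Suc l) a c))
        (rmsnorm eps dm (half_layer dm dh eps cqk R S \<theta> (Suc l) (residual dm dh eps cqk R S \<theta> x l) t)) j \<noteq> 0"
    by (intro AE_finite_allI finite_token_seqs finite_lessThan)
      (use AE_pre_activation_nonzero assms in auto)
  \<comment> \<open>The witness left open by \<open>exI\<close> is fixed here as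
    \<open>?C\<^sup>2\<close>, in which none of \<open>V\<close>, \<open>T\<close>,
    \<open>R\<close>, \<open>S\<close>, \<open>D\<close> occurs. \<open>AE_space\<close> makes
    \<theta> extensional, as the locale demands.\<close>
  with AE_space
  show "AE \<theta> in param_space L dm V. \<exists>A.
       has_hessian_on ?I (potential L dm dh eps tau cqk V T R S D) A \<theta> \<and>
       loewner_ge_on ?I A (\<lambda>i j. - (?C\<^sup>2) * (1 + L2_set \<theta> ?I) ^ (12 * L + 2) * id_matrix i j)"
  proof eventually_elim
    case (elim \<theta>)
    interpret transformer_at L dm H dh V T eps cqk R S \<theta>
      by unfold_locales (use assms R S elim(1) in \<open>auto simp: space_PiM\<close>)
    let ?b = "5 * ((1 + 2 / tau) * (proj_const dm * (\<rho> * (rms_const eps dm * (layer_const eps cqk dm dh * \<rho>^6) ^ L))))"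
    have "jet_le ?I \<theta> (potential L dm dh eps tau cqk V T R S D) ?b"
      by (rule jet_le_potential[OF D], rule jet_seq_loss[OF _ assms(6) V T]) (use elim(2) in auto)
    from jet_le_imp_loewner[OF finite_params this]
    obtain A where A: "has_hessian_on ?I (potential L dm dh eps tau cqk V T R S D) A \<theta>"
      "loewner_ge_on ?I A (\<lambda>i j. - (?b\<^sup>2) * id_matrix i j)" by blast
    \<comment> \<open>The layers contribute the exponent \<open>6 * L\<close> and the head 1;
      squaring gives \<open>12 * L + 2\<close>.\<close>
    have "(\<rho>^6) ^ L = \<rho> ^ (6 * L)" by (simp flip: power_mult)
    hence b: "?b = ?C * \<rho> ^ (6 * L + 1)" by (simp add: hessian_const_def power_mult_distrib)
    have "(\<rho> ^ (6 * L + 1))\<^sup>2 = \<rho> ^ ((6 * L + 1) * 2)" by (rule power_mult[symmetric])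
    also have "(6 * L + 1) * 2 = 12 * L + 2" by simp
    finally have "(?C * \<rho> ^ (6 * L + 1))\<^sup>2 = ?C\<^sup>2 * \<rho> ^ (12 * L + 2)"
      by (simp only: power_mult_distrib[of ?C])
    hence b2: "?b\<^sup>2 = ?C\<^sup>2 * \<rho> ^ (12 * L + 2)" unfolding b .
    have "- (?b\<^sup>2) = - (?C\<^sup>2) * (1 + L2_set \<theta> ?I) ^ (12 * L + 2)"
      unfolding b2 unfolding \<rho>_def by (rule minus_mult_left)
    from A(2)[unfolded this] A(1) show ?case by blast
  qed
qed

end
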